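(* Under Assumptions 1 and 2 (stated in the context), $$\inf_{K\in\mathcal{K}_\beta}J_{\mathrm{mix}}(K)=\min_{(\gamma,X,Y)\in\mathcal{F}_{\mathrm{cvx}}}\gamma,$$ where the minimum on the right-hand side is attained.
   Context: Let $A\in\mathbb{R}^{n\times n}$, $B\in\mathbb{R}^{n\times m}$, $B_w\in\mathbb{R}^{n\times n}$, $W:=B_wB_w^{\mathsf T}$. Let $Q_2\succeq0$, $R_2\succ0$, $Q_\infty\succ0$, $R_\infty\succ0$ be symmetric weight matrices and $\beta>0$. For $K\in\mathbb{R}^{m\times n}$ write $A_K:=A+BK$, $S_K:=Q_\infty+K^{\mathsf T}R_\infty K$. Let $\mathcal{K}:=\{K: A_K \text{ Hurwitz}\}$, $\mathbf{T}_\infty(K)(s)=\begin{bmatrix}Q_\infty^{1/2}\\ R_\infty^{1/2}K\end{bmatrix}(sI-A_K)^{-1}B_w$, $\mathcal{K}_\beta:=\{K\in\mathcal{K}:\|\mathbf{T}_\infty(K)\|_{\mathcal{H}_\infty}<\beta\}$. For $K\in\mathcal{K}_\beta$ let $X_K$ be the unique stabilizing solution (i.e. $A_K+\beta^{-2}X_KS_K$ Hurwitz) of $A_KX+XA_K^{\mathsf T}+\beta^{-2}XS_KX+W=0$ and $J_{\mathrm{mix}}(K):=\operatorname{tr}((Q_2+K^{\mathsf T}R_2K)X_K)$. $\mathcal{F}_{\mathrm{cvx}}:=\{(\gamma,X,Y):\gamma\in\mathbb{R},X\succ0,Y\in\mathbb{R}^{m\times n},\ \mathbb{F}_{\mathrm{cvx}}(X,Y)\preceq0,\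 \gamma\ge\operatorname{tr}(Q_2X)+\operatorname{tr}(R_2YX^{-1}Y^{\mathsf T})\}$, where $\mathbb{F}_{\mathrm{cvx}}(X,Y):=\begin{bmatrix}AX+XA^{\mathsf T}+BY+Y^{\mathsf T}B^{\mathsf T}+W & XQ_\infty^{1/2} & Y^{\mathsf T}R_\infty^{1/2}\\ Q_\infty^{1/2}X & -\beta^2I & 0\\ R_\infty^{1/2}Y & 0 & -\beta^2I\end{bmatrix}$. Assumption 1: $(A,B)$ stabilizable, $(Q_2^{1/2},A)$ detectable, and $\beta>\inf_{K\in\mathcal{K}}\|\mathbf{T}_\infty(K)\|_{\mathcal{H}_\infty}$. Assumption 2: $Q_2\succeq0$ and $W,Q_\infty,R_2,R_\infty$ positive definite. *)

theory Defs
  imports "HOL-Analysis.Analysis"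
begin

definition cmat :: "real^'c^'r \<Rightarrow> complex^'c^'r" where
  "cmat M = (\<chi> i j. complex_of_real (M $ i $ j))"

definition hurwitz :: "real^'n^'n \<Rightarrow> bool" where
  "hurwitz M \<longleftrightarrow> (\<forall>(lam::complex) (v::complex^'n).
      v \<noteq> 0 \<and> cmat M *v v = lam *s v \<longrightarrow> Re lam < 0)"

definition sym_mat :: "real^'n^'n \<Rightarrow> bool" where
  "sym_mat M \<longleftrightarrow> transpose M = M"

definition psd :: "real^'n^'n \<Rightarrow> bool" where
  "psd M \<longleftrightarrow> sym_mat M \<and> (\<forall>x. 0 \<le> x \<bullet> (M *v x))"

definition pd :: "real^'n^'n \<Rightarrow> bool" where
  "pd M \<longleftrightarrow> sym_mat M \<and> (\<forall>x. x \<noteq> 0 \<longrightarrow> 0 < x \<bullet> (M *v x))"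

definition msqrt :: "real^'n^'n \<Rightarrow> real^'n^'n" where
  "msqrt M = (THE S. psd S \<and> S ** S = M)"

definition closed_loop :: "real^'n^'n \<Rightarrow> real^'m^'n \<Rightarrow> real^'n^'m \<Rightarrow> real^'n^'n" where
  "closed_loop A B K = A + B ** K"

definition stabilizing_set :: "real^'n^'n \<Rightarrow> real^'m^'n \<Rightarrow> (real^'n^'m) set" where
  "stabilizing_set A B = {K. hurwitz (closed_loop A B K)}"

definition out_mat :: "real^'n^'n \<Rightarrow> real^'m^'m \<Rightarrow> real^'n^'m \<Rightarrow> real^'n^('n + 'm)" where
  "out_mat Qi Ri K = (\<chi> i. case i of Inl a \<Rightarrow> msqrt Qi $ a | Inr b \<Rightarrow> (msqrt Ri ** K) $ b)"

definition Tinf :: "real^'n^'n \<Rightarrow> real^'m^'n \<Rightarrow> real^'n^'n \<Rightarrow> real^'n^'n \<Rightarrow> real^'m^'m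
                    \<Rightarrow> real^'n^'m \<Rightarrow> complex \<Rightarrow> complex^'n^('n + 'm)" where
  "Tinf A B Bw Qi Ri K s =
     cmat (out_mat Qi Ri K) ** matrix_inv (mat s - cmat (closed_loop A B K)) ** cmat Bw"

text \<open>H-infinity norm: supremum over the imaginary axis of the largest singular value
  (the operator norm induced by the Euclidean norms).\<close>
definition hinf_norm :: "real^'n^'n \<Rightarrow> real^'m^'n \<Rightarrow> real^'n^'n \<Rightarrow> real^'n^'n \<Rightarrow> real^'m^'m
                    \<Rightarrow> real^'n^'m \<Rightarrow> real" where
  "hinf_norm A B Bw Qi Ri K =
     (SUP w::real. onorm (\<lambda>v. Tinf A B Bw Qi Ri K (\<i> * complex_of_real w) *v v))"

definition Kbeta :: "real^'n^'n \<Rightarrow> real^'m^'n \<Rightarrow> real^'n^'n \<Rightarrow> real^'n^'n \<Rightarrow> real^'m^'m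
                    \<Rightarrow> real \<Rightarrow> (real^'n^'m) set" where
  "Kbeta A B Bw Qi Ri beta = {K \<in> stabilizing_set A B. hinf_norm A B Bw Qi Ri K < beta}"

definition SK :: "real^'n^'n \<Rightarrow> real^'m^'m \<Rightarrow> real^'n^'m \<Rightarrow> real^'n^'n" where
  "SK Qi Ri K = Qi + transpose K ** Ri ** K"

definition riccati_stab_sol :: "real^'n^'n \<Rightarrow> real^'m^'n \<Rightarrow> real^'n^'n \<Rightarrow> real^'n^'n \<Rightarrow> real^'m^'m
                    \<Rightarrow> real \<Rightarrow> real^'n^'m \<Rightarrow> real^'n^'n \<Rightarrow> bool" where
  "riccati_stab_sol A B Bw Qi Ri beta K X \<longleftrightarrow>
     sym_mat X \<and>
     closed_loop A B K ** X + X ** transpose (closed_loop A B K)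
       + (inverse (beta^2)) *\<^sub>R (X ** SK Qi Ri K ** X) + Bw ** transpose Bw = 0 \<and>
     hurwitz (closed_loop A B K + (inverse (beta^2)) *\<^sub>R (X ** SK Qi Ri K))"

definition XK :: "real^'n^'n \<Rightarrow> real^'m^'n \<Rightarrow> real^'n^'n \<Rightarrow> real^'n^'n \<Rightarrow> real^'m^'m
                    \<Rightarrow> real \<Rightarrow> real^'n^'m \<Rightarrow> real^'n^'n" where
  "XK A B Bw Qi Ri beta K = (THE X. riccati_stab_sol A B Bw Qi Ri beta K X)"

definition Jmix :: "real^'n^'n \<Rightarrow> real^'m^'n \<Rightarrow> real^'n^'n \<Rightarrow> real^'n^'n \<Rightarrow> real^'m^'m
                    \<Rightarrow> real^'n^'n \<Rightarrow> real^'m^'m \<Rightarrow> real \<Rightarrow> real^'n^'m \<Rightarrow> real" where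
  "Jmix A B Bw Q2 R2 Qi Ri beta K =
     trace ((Q2 + transpose K ** R2 ** K) ** XK A B Bw Qi Ri beta K)"

definition Fcvx :: "real^'n^'n \<Rightarrow> real^'m^'n \<Rightarrow> real^'n^'n \<Rightarrow> real^'n^'n \<Rightarrow> real^'m^'m
                    \<Rightarrow> real \<Rightarrow> real^'n^'n \<Rightarrow> real^'n^'m \<Rightarrow> real^(('n + 'n) + 'm)^(('n + 'n) + 'm)" where
  "Fcvx A B Bw Qi Ri beta X Y =
     (let M11 = A ** X + X ** transpose A + B ** Y + transpose Y ** transpose B + Bw ** transpose Bw;
          M12 = X ** msqrt Qi;
          M13 = transpose Y ** msqrt Ri;
          M21 = msqrt Qi ** X;
          M31 = msqrt Ri ** Y
      in (\<chi> i j. case i of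
            Inl (Inl a) \<Rightarrow> (case j of Inl (Inl b) \<Rightarrow> M11 $ a $ b | Inl (Inr b) \<Rightarrow> M12 $ a $ b
                                     | Inr b \<Rightarrow> M13 $ a $ b)
          | Inl (Inr a) \<Rightarrow> (case j of Inl (Inl b) \<Rightarrow> M21 $ a $ b
                                     | Inl (Inr b) \<Rightarrow> (if a = b then - (beta^2) else 0)
                                     | Inr b \<Rightarrow> 0)
          | Inr a \<Rightarrow> (case j of Inl (Inl b) \<Rightarrow> M31 $ a $ b | Inl (Inr b) \<Rightarrow> 0
                                | Inr b \<Rightarrow> (if a = b then - (beta^2) else 0))))"

definition Fcvx_set :: "real^'n^'n \<Rightarrow> real^'m^'n \<Rightarrow> real^'n^'n \<Rightarrow> real^'n^'n \<Rightarrow> real^'m^'m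
                    \<Rightarrow> real^'n^'n \<Rightarrow> real^'m^'m \<Rightarrow> real \<Rightarrow> (real \<times> (real^'n^'n) \<times> (real^'n^'m)) set" where
  "Fcvx_set A B Bw Q2 R2 Qi Ri beta =
     {(gam, X, Y). pd X \<and> psd (- Fcvx A B Bw Qi Ri beta X Y) \<and>
        gam \<ge> trace (Q2 ** X) + trace (R2 ** Y ** matrix_inv X ** transpose Y)}"

end

(* With W positive definite, every K in Kbeta has a stabilizing Riccati solution X_K, and
   (X_K, K X_K) satisfies the LMI with equality; conversely a pair (X, K X) that satisfies the LMI
   strictly has K in Kbeta, and X dominates X_K. A feasible pair is a limit of strictly feasible ones
   (mix it with X_K0 + e D, where D solves a Lyapunov equation), along which the cost is convex,
   so the infimum and the minimum agree. The minimum exists because Q_inf and R_inf bound X and Y on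
   the feasible set, while W bounds X away from singular matrices on cost sublevel sets.

   Instead of spectral subspaces, everything about Riccati equations uses continuation in a parameter
   t in [0,1]: solvability is open by Brouwer's theorem and closed by compactness, and a limit of
   Hurwitz matrices that is not Hurwitz has an imaginary eigenvalue, which the bound on the
   H-infinity norm excludes. The same continuation yields Lyapunov's theorem and square roots. *)

theory Submission
  imports Defs "HOL-Computational_Algebra.Fundamental_Theorem_Algebra"
begin

section \<open>Positive definite matrices and Lyapunov equations\<close>

text \<open>A minimiser of the convex problem may satisfy the LMI only non-strictly, and then
  nothing places its gain in \<open>Kbeta\<close>. Hence the two values are compared through
  strictly feasible pairs, and attainment is claimed on the convex side alone. Convexity lives in
  the variables X and Y = K X: with a = X v and b = Y v, the quadratic form of the LMI at v is
  affine plus a positive semidefinite quadratic in (a, b). Compactness is argued in (X, K) instead,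
  where residual and cost are polynomial. Perturbation, comparison and strict feasibility share one
  algebraic fact: the Riccati map is exactly quadratic, and its derivative at X is the Lyapunov
  operator of A + X S. Stability is therefore handled as the existence of a positive definite P with
  M P + P M^T negative definite (\<open>lyap\<close>). This form is visibly open and decides the
  sign of Lyapunov solutions without a spectral decomposition; complex eigenvectors serve to connect
  it with \<open>hurwitz\<close> and to rule out degenerate limits. Along the continuation, positive
  definiteness of S_K makes the quadratic term dominate, so that solutions cannot escape to
  infinity.\<close>

declare transpose_matrix_vector [simp del] vector_transpose_matrix [simp del]

lemma transpose_add: "transpose (M + N) = transpose M + transpose N"
  by (simp add: transpose_def vec_eq_iff)

lemma transpose_minus: "transpose (- M) = - transpose M"
  by (simp add: transpose_def vec_eq_iff)

lemma transpose_diff: "transpose (M - N) = transpose M - transpose N"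
  by (simp add: transpose_def vec_eq_iff)

lemma transpose_zero [simp]: "transpose 0 = 0"
  by (simp add: transpose_def vec_eq_iff)

lemma matrix_add_rdistrib: "((B + C) ** A) = (B ** A) + (C ** A)"
  by (vector matrix_matrix_mult_def sum.distrib[symmetric] field_simps)

lemma matrix_mul_minus_left: "(- M) ** N = - (M ** N)" for M :: "'a::ring_1^'n^'m"
  by (vector matrix_matrix_mult_def sum_negf)

lemma matrix_mul_minus_right: "M ** (- N) = - (M ** N)" for M :: "'a::ring_1^'n^'m"
  by (vector matrix_matrix_mult_def sum_negf)

lemma matrix_mul_diff_left: "(M - L) ** N = M ** N - L ** N" for M :: "'a::ring_1^'n^'m"
  by (metis matrix_add_rdistrib matrix_mul_minus_left diff_conv_add_uminus)

lemma matrix_mul_diff_right: "M ** (N - L) = M ** N - M ** L" for M :: "'a::ring_1^'n^'m"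
  by (metis matrix_add_ldistrib matrix_mul_minus_right diff_conv_add_uminus)

lemma matrix_vector_mul_uminus: "(- M) *v x = - (M *v x)" for M :: "'a::ring_1^'n^'m"
  by (vector matrix_vector_mult_def sum_negf)

lemma matrix_vector_mul_uminus_right: "M *v (- x) = - (M *v x)" for M :: "'a::ring_1^'n^'m"
  by (vector matrix_vector_mult_def sum_negf)

lemma scaleR_matrix_vector: "(c *\<^sub>R M) *v x = c *\<^sub>R (M *v x)" for M :: "real^'n^'m"
  by (simp add: scaleR_matrix_vector_assoc)

lemma scaleR_matrix_mul_left: "(c *\<^sub>R M) ** N = c *\<^sub>R (M ** N)" for M :: "real^'n^'m"
  by (simp add: scalar_matrix_assoc)

lemma scaleR_matrix_mul_right: "M ** (c *\<^sub>R N) = c *\<^sub>R (M ** N)" for M :: "real^'n^'m"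
  by (simp add: matrix_scalar_ac scalar_matrix_assoc)

lemmas matrix_algebra = matrix_add_ldistrib matrix_add_rdistrib matrix_mul_minus_left
  matrix_mul_minus_right matrix_mul_diff_left matrix_mul_diff_right scaleR_matrix_mul_left
  scaleR_matrix_mul_right matrix_mul_assoc

lemmas transpose_algebra = transpose_add transpose_minus transpose_diff transpose_scalar
  matrix_transpose_mul

lemmas matrix_vector_algebra = matrix_vector_mul_assoc[symmetric] matrix_vector_right_distrib
  matrix_vector_mult_diff_distrib matrix_vector_mult_scaleR matrix_vector_mult_add_rdistrib
  matrix_vector_mult_diff_rdistrib matrix_vector_mul_uminus matrix_vector_mul_uminus_right
  scaleR_matrix_vector

lemma inner_matrix_vector: "x \<bullet> (M *v y) = (transpose M *v x) \<bullet> y" for M :: "real^'n^'m"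
  by (simp add: transpose_matrix_vector dot_lmul_matrix)

lemma sym_matD: "sym_mat M \<Longrightarrow> transpose M = M"
  by (simp add: sym_mat_def)

lemma sym_mat_inner: "sym_mat M \<Longrightarrow> x \<bullet> (M *v y) = (M *v x) \<bullet> y"
  by (metis inner_matrix_vector sym_matD)

lemma sym_mat_simps [simp]:
  "sym_mat 0" "sym_mat (mat c)"
  by (simp_all add: sym_mat_def)

lemma sym_mat_add: "sym_mat M \<Longrightarrow> sym_mat N \<Longrightarrow> sym_mat (M + N)"
  by (simp add: sym_mat_def transpose_add)

lemma sym_mat_diff: "sym_mat M \<Longrightarrow> sym_mat N \<Longrightarrow> sym_mat (M - N)"
  by (simp add: sym_mat_def transpose_diff)

lemma sym_mat_minus: "sym_mat M \<Longrightarrow> sym_mat (- M)"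
  by (simp add: sym_mat_def transpose_minus)

lemma sym_mat_scaleR: "sym_mat M \<Longrightarrow> sym_mat (c *\<^sub>R M)"
  by (simp add: sym_mat_def transpose_scalar)

lemma sym_mat_congruence: "sym_mat M \<Longrightarrow> sym_mat (N ** M ** transpose N)"
  by (simp add: sym_mat_def matrix_transpose_mul matrix_mul_assoc)

lemma sym_mat_sandwich: "sym_mat M \<Longrightarrow> sym_mat N \<Longrightarrow> sym_mat (N ** M ** N)"
  by (simp add: sym_mat_def matrix_transpose_mul matrix_mul_assoc)

lemma sym_mat_lyapunov: "sym_mat X \<Longrightarrow> sym_mat (M ** X + X ** transpose M)"
  by (simp add: sym_mat_def matrix_transpose_mul transpose_add add.commute)

lemmas sym_mat_intros = sym_mat_simps sym_mat_add sym_mat_diff sym_mat_minus sym_mat_scaleR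
  sym_mat_lyapunov sym_mat_sandwich

lemma inner_lyapunov:
  fixes M X :: "real^'n^'n"
  assumes "sym_mat X"
  shows "x \<bullet> ((M ** X + X ** transpose M) *v x) = 2 * ((X *v x) \<bullet> (transpose M *v x))"
  by (simp add: matrix_vector_algebra inner_add_right inner_matrix_vector[of x M]
      sym_mat_inner[OF assms, of x] inner_commute)

lemma psdD: "psd M \<Longrightarrow> 0 \<le> x \<bullet> (M *v x)" and psd_sym: "psd M \<Longrightarrow> sym_mat M"
  by (auto simp: psd_def)

lemma pdD: "pd M \<Longrightarrow> x \<noteq> 0 \<Longrightarrow> 0 < x \<bullet> (M *v x)" and pd_sym: "pd M \<Longrightarrow> sym_mat M"
  by (auto simp: pd_def)

lemma pd_imp_psd: "pd M \<Longrightarrow> psd M"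
  unfolding pd_def psd_def by (metis inner_zero_left less_eq_real_def)

lemma pd_mat: "c > 0 \<Longrightarrow> pd (c *\<^sub>R mat 1)"
  by (simp add: pd_def sym_mat_scaleR scaleR_matrix_vector)

lemma pd_mat1: "pd (mat 1)"
  by (simp add: pd_def)

lemma pd_scaleR: "c > 0 \<Longrightarrow> pd M \<Longrightarrow> pd (c *\<^sub>R M)"
  by (simp add: pd_def sym_mat_scaleR scaleR_matrix_vector)

lemma psd_scaleR: "c \<ge> 0 \<Longrightarrow> psd M \<Longrightarrow> psd (c *\<^sub>R M)"
  by (simp add: psd_def sym_mat_scaleR scaleR_matrix_vector)

lemma pd_add_psd: "pd M \<Longrightarrow> psd N \<Longrightarrow> pd (M + N)"
  by (simp add: pd_def psd_def sym_mat_add matrix_vector_algebra inner_add_right add_pos_nonneg)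

lemma psd_add: "psd M \<Longrightarrow> psd N \<Longrightarrow> psd (M + N)"
  by (simp add: psd_def sym_mat_add matrix_vector_algebra inner_add_right)

lemma psd_congruence: "psd M \<Longrightarrow> psd (N ** M ** transpose N)" for N :: "real^'n^'m"
proof -
  assume M: "psd M"
  have "x \<bullet> ((N ** M ** transpose N) *v x) = (transpose N *v x) \<bullet> (M *v (transpose N *v x))" for x
    by (simp add: matrix_vector_algebra inner_matrix_vector[of x N])
  with M show ?thesis by (simp add: psd_def sym_mat_congruence)
qed

lemma psd_sandwich: "psd M \<Longrightarrow> sym_mat N \<Longrightarrow> psd (N ** M ** N)"
  using psd_congruence[of M N] by (simp add: sym_matD)

lemma psd_cauchy_schwarz:
  assumes "psd M"
  shows "(x \<bullet> (M *v y))\<^sup>2 \<le> (x \<bullet> (M *v x)) * (y \<bullet> (M *v y))"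
proof -
  define a b c where "a = x \<bullet> (M *v x)" and "b = x \<bullet> (M *v y)" and "c = y \<bullet> (M *v y)"
  have sym: "y \<bullet> (M *v x) = b"
    unfolding b_def using sym_mat_inner[OF psd_sym[OF assms]] by (simp add: inner_commute)
  have q: "0 \<le> a + 2 * t * b + t\<^sup>2 * c" for t
    using psdD[OF assms, of "x + t *\<^sub>R y"]
    by (simp add: matrix_vector_algebra inner_add_left inner_add_right a_def sym flip: b_def c_def)
       (simp add: b_def c_def power2_eq_square algebra_simps)
  have "b\<^sup>2 \<le> a * c"
  proof (cases "c = 0")
    case True
    have "b = 0"
    proof (rule ccontr)
      assume "b \<noteq> 0"
      \<comment> \<open>With c = 0 the polynomial in t is affine, and this t gives it the value
        -1.\<close>
      with q[of "- (a + 1) / (2 * b)"] True show False by (simp add: field_simps)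
    qed
    with True show ?thesis by simp
  next
    case False
    then have "c > 0" using psdD[OF assms, of y] by (simp add: c_def)
    with q[of "- b / c"] show ?thesis by (simp add: field_simps power2_eq_square)
  qed
  then show ?thesis by (simp add: a_def b_def c_def)
qed

text \<open>Cauchy-Schwarz between \<open>M *v x\<close> and \<open>x\<close>, where the factor
  belonging to \<open>x\<close> vanishes.\<close>

lemma psd_kernel:
  assumes "psd M" "x \<bullet> (M *v x) = 0"
  shows "M *v x = 0"
proof -
  have "((M *v x) \<bullet> (M *v x))\<^sup>2 \<le> 0"
    using psd_cauchy_schwarz[OF assms(1), of "M *v x" x] assms(2) by simp
  then show ?thesis by simp
qed

lemma psd_imp_pd: "psd M \<Longrightarrow> (\<And>x. M *v x = 0 \<Longrightarrow> x = 0) \<Longrightarrow> pd M"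
  unfolding pd_def using psd_kernel[of M] by (metis less_eq_real_def psdD psd_sym)

lemma pd_kernel: "pd M \<Longrightarrow> M *v x = 0 \<Longrightarrow> x = 0"
  using pdD[of M x] by (metis inner_zero_right less_irrefl)

lemma pd_invertible:
  assumes "pd M"
  shows "invertible M"
  using pd_kernel[OF assms] matrix_left_invertible_ker[of M] matrix_left_right_inverse
  unfolding invertible_def by metis

lemma matrix_inv_mul:
  fixes M :: "'a::semiring_1^'n^'n"
  assumes "invertible M"
  shows "M ** matrix_inv M = mat 1" "matrix_inv M ** M = mat 1"
  using someI_ex[OF assms[unfolded invertible_def]] by (auto simp: matrix_inv_def)

lemma bounded_bilinear_matrix_mult:
  "bounded_bilinear ((**) :: real^'n^'m \<Rightarrow> real^'p^'n \<Rightarrow> real^'p^'m)"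
proof -
  have "bilinear ((**) :: real^'n^'m \<Rightarrow> real^'p^'n \<Rightarrow> real^'p^'m)"
    by (auto simp: bilinear_def linear_iff matrix_algebra)
  then show ?thesis by (simp add: bilinear_conv_bounded_bilinear)
qed

lemma bounded_bilinear_matrix_vector_mult:
  "bounded_bilinear ((*v) :: real^'n^'m \<Rightarrow> real^'n \<Rightarrow> real^'m)"
proof -
  have "bilinear ((*v) :: real^'n^'m \<Rightarrow> real^'n \<Rightarrow> real^'m)"
    by (auto simp: bilinear_def linear_iff matrix_vector_algebra)
  then show ?thesis by (simp add: bilinear_conv_bounded_bilinear)
qed

lemma bounded_linear_transpose: "bounded_linear (transpose :: real^'n^'m \<Rightarrow> real^'m^'n)"
  by (simp add: linear_conv_bounded_linear[symmetric] linear_iff transpose_algebra)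

lemmas tendsto_matrix [tendsto_intros] =
  bounded_bilinear.tendsto[OF bounded_bilinear_matrix_mult]
  bounded_bilinear.tendsto[OF bounded_bilinear_matrix_vector_mult]
  bounded_linear.tendsto[OF bounded_linear_transpose]

lemmas continuous_on_matrix [continuous_intros] =
  bounded_bilinear.continuous_on[OF bounded_bilinear_matrix_mult]
  bounded_bilinear.continuous_on[OF bounded_bilinear_matrix_vector_mult]
  bounded_linear.continuous_on[OF bounded_linear_transpose]

lemma sym_mat_limit:
  assumes "f \<longlonglongrightarrow> (M::real^'n^'n)" "\<And>k. sym_mat (f k)"
  shows "sym_mat M"
proof -
  have "(\<lambda>k. transpose (f k)) \<longlonglongrightarrow> transpose M" by (intro tendsto_intros assms)
  moreover have "(\<lambda>k. transpose (f k)) = f" using assms(2) by (auto simp: sym_mat_def)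
  ultimately show ?thesis unfolding sym_mat_def using assms(1) LIMSEQ_unique by metis
qed

lemma psd_limit:
  assumes "f \<longlonglongrightarrow> (M::real^'n^'n)" "\<And>k. psd (f k)"
  shows "psd M"
  unfolding psd_def
proof (intro conjI allI)
  show "sym_mat M" using sym_mat_limit[OF assms(1)] assms(2) by (simp add: psd_def)
  fix x
  have "(\<lambda>k. x \<bullet> (f k *v x)) \<longlonglongrightarrow> x \<bullet> (M *v x)" by (intro tendsto_intros assms)
  then show "0 \<le> x \<bullet> (M *v x)"
    by (rule LIMSEQ_le_const) (use assms(2) in \<open>auto simp: psd_def\<close>)
qed

text \<open>The Rayleigh quotient relative to \<open>P\<close> attains its minimum \<open>m\<close>
  on the compact unit sphere, and homogeneity carries the bound to all vectors. For symmetric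
  \<open>N\<close> the minimiser is a generalised eigenvector, which is how \<open>lyap_psd\<close>
  uses it.\<close>

lemma quadratic_form_min:
  fixes N P :: "real^'n^'n"
  assumes "pd P"
  obtains m v where "v \<noteq> 0" "v \<bullet> (N *v v) = m * (v \<bullet> (P *v v))"
    "\<And>x. m * (x \<bullet> (P *v x)) \<le> x \<bullet> (N *v x)"
proof -
  define f where "f x = (x \<bullet> (N *v x)) / (x \<bullet> (P *v x))" for x :: "real^'n"
  have "continuous_on (sphere 0 1) f"
    unfolding f_def using pd_kernel[OF assms] pdD[OF assms]
    by (intro continuous_intros) (metis dist_0_norm less_irrefl mem_sphere norm_zero zero_neq_one)
  moreover have "sphere (0::real^'n) 1 \<noteq> {}" by simp
  ultimately obtain v where v: "v \<in> sphere 0 1" "\<And>x. x \<in> sphere 0 1 \<Longrightarrow> f v \<le> f x"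
    using continuous_attains_inf[of "sphere 0 1" f] by (metis compact_sphere)
  have v0: "v \<noteq> 0" using v(1) by auto
  have "f v * (x \<bullet> (P *v x)) \<le> x \<bullet> (N *v x)" for x
  proof (cases "x = 0")
    case False
    have "f x = f ((1 / norm x) *\<^sub>R x)"
      using False by (simp add: f_def matrix_vector_mult_scaleR)
    moreover have "f v \<le> f ((1 / norm x) *\<^sub>R x)"
      by (rule v(2)) (use False in simp)
    ultimately show ?thesis
      using pdD[OF assms False] by (metis f_def pos_le_divide_eq)
  qed simp
  moreover have "v \<bullet> (N *v v) = f v * (v \<bullet> (P *v v))"
    using pdD[OF assms v0] by (simp add: f_def)
  ultimately show ?thesis using that v0 by blast
qed

lemma pd_dominates:
  fixes N P :: "real^'n^'n"
  assumes "pd N" "pd P"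
  obtains m where "m > 0" "\<And>x. m * (x \<bullet> (P *v x)) \<le> x \<bullet> (N *v x)"
proof -
  obtain m v where m: "v \<noteq> 0"
    "v \<bullet> (N *v v) = m * (v \<bullet> (P *v v))" "\<And>x. m * (x \<bullet> (P *v x)) \<le> x \<bullet> (N *v x)"
    by (rule quadratic_form_min[OF assms(2), of N], blast)
  have "m > 0" using pdD[OF assms(1) m(1)] pdD[OF assms(2) m(1)] m(2)
    by (simp add: zero_less_mult_iff)
  with m(3) that show ?thesis by blast
qed

lemma pd_elliptic:
  fixes N :: "real^'n^'n"
  assumes "pd N"
  obtains m where "m > 0" "\<And>x. m * (x \<bullet> x) \<le> x \<bullet> (N *v x)"
  using pd_dominates[OF assms pd_mat1] by (metis matrix_vector_mul_lid)

text \<open>On unit vectors the form of \<open>N\<close> stays above some m > 0. A perturbation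
  smaller than m divided by the norm constant of matrix-vector multiplication cannot destroy
  this.\<close>

lemma pd_open:
  fixes N :: "real^'n^'n"
  assumes "pd N"
  obtains d where "d > 0" "\<And>N'. sym_mat N' \<Longrightarrow> norm (N' - N) < d \<Longrightarrow> pd N'"
proof -
  obtain m where m: "m > 0" "\<And>x. m * (x \<bullet> x) \<le> x \<bullet> (N *v x)" by (rule pd_elliptic[OF assms], blast)
  obtain K where K: "K > 0" "\<And>(M::real^'n^'n) x. norm (M *v x) \<le> norm M * norm x * K"
    using bounded_bilinear.pos_bounded[OF bounded_bilinear_matrix_vector_mult] by blast
  have "pd N'" if N': "sym_mat N'" "norm (N' - N) < m / K" for N'
    unfolding pd_def
  proof (intro conjI allI impI N'(1))
    fix x :: "real^'n" assume x: "x \<noteq> 0"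
    have "\<bar>x \<bullet> ((N' - N) *v x)\<bar> \<le> norm x * norm ((N' - N) *v x)" by (rule Cauchy_Schwarz_ineq2)
    also have "\<dots> \<le> norm x * (norm (N' - N) * norm x * K)"
      by (intro mult_left_mono K) auto
    also have "\<dots> < norm x * (m / K * norm x * K)"
      using x K(1) N'(2) by (intro mult_strict_left_mono mult_strict_right_mono) auto
    also have "\<dots> = m * (x \<bullet> x)" using K(1) by (simp add: dot_square_norm power2_eq_square)
    finally show "0 < x \<bullet> (N' *v x)" using m(2)[of x]
      by (simp add: matrix_vector_algebra inner_diff_right)
  qed
  then show ?thesis using that[of "m / K"] m K by auto
qed

text \<open>Stability by certificate, shown equivalent to \<open>hurwitz\<close> in
  \<open>hurwitz_iff_lyap\<close>. The transpose stands on the right factor because the Riccati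
  equation has the linear part A X + X A^T.\<close>

definition lyap :: "real^'n^'n \<Rightarrow> bool" where
  "lyap M \<longleftrightarrow> (\<exists>P. pd P \<and> pd (- (M ** P + P ** transpose M)))"

text \<open>Let m be the least generalised eigenvalue of \<open>X\<close> relative to the
  certificate \<open>P\<close>, so that X v = m P v. The Lyapunov form of \<open>X\<close> at v is
  then m times that of \<open>P\<close>; the latter is negative, so m < 0 would make the former
  positive.\<close>

lemma lyap_psd:
  assumes "lyap M" "sym_mat X" "psd (- (M ** X + X ** transpose M))"
  shows "psd X"
proof -
  obtain P where P: "pd P" "pd (- (M ** P + P ** transpose M))" using assms(1) lyap_def by blast
  obtain m v where m: "v \<noteq> 0" "v \<bullet> (X *v v) = m * (v \<bullet> (P *v v))"
    "\<And>x. m * (x \<bullet> (P *v x)) \<le> x \<bullet> (X *v x)"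
    by (rule quadratic_form_min[OF P(1), of X], blast)
  have "m \<ge> 0"
  proof (rule ccontr)
    assume "\<not> m \<ge> 0"
    then have "m < 0" by simp
    have "psd (X - m *\<^sub>R P)"
      using m(3) assms(2) pd_sym[OF P(1)]
      by (simp add: psd_def sym_mat_intros matrix_vector_algebra inner_diff_right)
    then have "(X - m *\<^sub>R P) *v v = 0"
      by (rule psd_kernel) (simp add: matrix_vector_algebra inner_diff_right m(2))
    then have Xv: "X *v v = m *\<^sub>R (P *v v)" by (simp add: matrix_vector_algebra)
    then have "v \<bullet> ((M ** X + X ** transpose M) *v v) = m * (v \<bullet> ((M ** P + P ** transpose M) *v v))"
      using inner_lyapunov[OF assms(2)] inner_lyapunov[OF pd_sym[OF P(1)]] by simp
    moreover have "v \<bullet> ((M ** P + P ** transpose M) *v v) < 0"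
      using pdD[OF P(2) m(1)] by (simp only: matrix_vector_mul_uminus inner_minus_right)
    moreover have "v \<bullet> ((M ** X + X ** transpose M) *v v) \<le> 0"
      using psdD[OF assms(3), of v]
      by (simp only: matrix_vector_mul_uminus inner_minus_right neg_0_le_iff_le)
    ultimately show False using \<open>m < 0\<close> by (smt (verit) mult_neg_neg)
  qed
  then show ?thesis using m(3) pdD[OF P(1)] assms(2) unfolding psd_def
    by (metis mult_nonneg_nonneg order_trans psdD[OF pd_imp_psd[OF P(1)]])
qed

text \<open>On a kernel vector of \<open>X\<close> the Lyapunov form vanishes, which strictness
  allows only for the zero vector.\<close>

lemma lyap_pd:
  assumes "lyap M" "sym_mat X" "pd (- (M ** X + X ** transpose M))"
  shows "pd X"
proof (rule psd_imp_pd)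
  show "psd X" using lyap_psd[OF assms(1,2) pd_imp_psd[OF assms(3)]] .
  fix x assume "X *v x = 0"
  then have "x \<bullet> ((- (M ** X + X ** transpose M)) *v x) = 0"
    using inner_lyapunov[OF assms(2), of x M] by (simp only: matrix_vector_mul_uminus) simp
  with pdD[OF assms(3)] show "x = 0" by force
qed

lemma psd_zero: "psd 0"
  by (simp add: psd_def)

lemma psd_antisym:
  assumes "psd X" "psd (- X)"
  shows "X = 0"
proof -
  have "X *v x = 0" for x
    using psd_kernel[OF assms(1)] psdD[OF assms(1), of x] psdD[OF assms(2), of x]
    by (simp add: matrix_vector_mul_uminus)
  then show ?thesis by (simp add: matrix_eq)
qed

lemma lyap_unique:
  assumes "lyap M" "sym_mat X" "M ** X + X ** transpose M = 0"
  shows "X = 0"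
proof (rule psd_antisym)
  show "psd X" by (rule lyap_psd[OF assms(1,2)]) (simp only: assms(3) psd_zero minus_zero)
  have *: "- (M ** (- X) + (- X) ** transpose M) = M ** X + X ** transpose M"
    by (simp add: matrix_algebra)
  show "psd (- X)"
    by (rule lyap_psd[OF assms(1) sym_mat_minus[OF assms(2)]]) (simp only: * assms(3) psd_zero)
qed

lemma lyap_solve:
  fixes M :: "real^'n^'n"
  assumes "lyap M"
  obtains g :: "real^'n^'n \<Rightarrow> real^'n^'n" where "linear g"
    "\<And>Q. sym_mat Q \<Longrightarrow> sym_mat (g Q) \<and> M ** g Q + g Q ** transpose M = Q"
proof -
  \<comment> \<open>\<open>L\<close> is the Lyapunov operator on symmetric matrices and the identity on skew-symmetric ones,
    so \<open>lyap_unique\<close>, which is about symmetric matrices only, makes it injective.\<close>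
  define s where "s Z = (1/2) *\<^sub>R (Z + transpose Z)" for Z :: "real^'n^'n"
  define a where "a Z = (1/2) *\<^sub>R (Z - transpose Z)" for Z :: "real^'n^'n"
  define L where "L Z = M ** s Z + s Z ** transpose M + a Z" for Z :: "real^'n^'n"
  have ss: "sym_mat (s Z)" "transpose (a Z) = - a Z" "Z = s Z + a Z" for Z
    by (auto simp: s_def a_def sym_mat_def transpose_algebra scaleR_add_right scaleR_diff_right)
  have sa: "X = 0 \<and> Y = 0" if "sym_mat X" "transpose Y = - Y" "X + Y = 0" for X Y :: "real^'n^'n"
  proof -
    have "X = - Y" using that(3) by (simp add: eq_neg_iff_add_eq_0)
    then have "Y = - Y" using that(1,2) by (simp add: sym_mat_def transpose_minus)
    then have "Y = 0" by (auto simp: vec_eq_iff)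
    with \<open>X = - Y\<close> show ?thesis by simp
  qed
  have lin: "linear L"
    by (auto simp: linear_iff L_def s_def a_def transpose_algebra matrix_algebra scaleR_add_right
        scaleR_diff_right mult.commute)
  have inj: "inj L"
  proof -
    have "Z = 0" if "L Z = 0" for Z
    proof -
      have *: "M ** s Z + s Z ** transpose M = 0 \<and> a Z = 0"
        using that unfolding L_def by (intro sa) (auto simp: ss sym_mat_lyapunov)
      then have "s Z = 0" using lyap_unique[OF assms ss(1)] by blast
      with * show ?thesis using ss(3)[of Z] by (metis add.right_neutral)
    qed
    then show ?thesis using linear_injective_0[OF lin] by blast
  qed
  obtain g where g: "linear g" "\<And>x. g (L x) = x" "\<And>x. L (g x) = x"
    using linear_injective_isomorphism[OF lin inj] by blast
  have "sym_mat (g Q) \<and> M ** g Q + g Q ** transpose M = Q" if "sym_mat Q" for Q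
  proof -
    have "(M ** s (g Q) + s (g Q) ** transpose M - Q) + a (g Q) = 0"
      using g(3)[of Q] by (simp add: L_def algebra_simps)
    then have "M ** s (g Q) + s (g Q) ** transpose M - Q = 0 \<and> a (g Q) = 0"
      by (intro sa) (auto simp: ss sym_mat_lyapunov sym_mat_diff that)
    then show ?thesis using ss(1,3)[of "g Q"] by simp
  qed
  with g(1) that show ?thesis by blast
qed

text \<open>Fixing the right-hand side turns certificates into solutions of an equation, which can
  be passed to the limit in \<open>lyap_limit\<close>.\<close>

lemma lyap_normalized:
  assumes "lyap M"
  obtains P where "pd P" "M ** P + P ** transpose M = - mat 1"
proof -
  obtain g where g: "\<And>Q. sym_mat Q \<Longrightarrow> sym_mat (g Q) \<and> M ** g Q + g Q ** transpose M = Q"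
    by (rule lyap_solve[OF assms], blast)
  have *: "sym_mat (g (- mat 1))" "M ** g (- mat 1) + g (- mat 1) ** transpose M = - mat 1"
    using g[of "- mat 1"] by (simp_all add: sym_mat_intros)
  have "pd (- (M ** g (- mat 1) + g (- mat 1) ** transpose M))"
    by (simp only: *(2) minus_minus pd_mat1)
  from lyap_pd[OF assms *(1) this] *(2) that show ?thesis by blast
qed

text \<open>One and the same certificate serves all matrices near \<open>M\<close>.\<close>

lemma lyap_open:
  assumes "lyap M"
  obtains d where "d > 0" "\<And>M'. norm (M' - M) < d \<Longrightarrow> lyap M'"
proof -
  obtain P where P: "pd P" "pd (- (M ** P + P ** transpose M))" using assms lyap_def by blast
  let ?f = "\<lambda>M. - (M ** P + P ** transpose M)"
  obtain e where e: "e > 0" "\<And>N. sym_mat N \<Longrightarrow> norm (N - ?f M) < e \<Longrightarrow> pd N"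
    by (rule pd_open[OF P(2)], blast)
  have "continuous_on UNIV ?f" by (intro continuous_intros)
  then obtain d where d: "d > 0" "\<And>M'. dist M' M < d \<Longrightarrow> dist (?f M') (?f M) < e"
    using e(1) unfolding continuous_on_iff by (metis UNIV_I)
  have "lyap M'" if "norm (M' - M) < d" for M'
    unfolding lyap_def using P(1) d(2)[of M'] that
    by (metis dist_norm e(2) pd_sym sym_mat_lyapunov sym_mat_minus)
  then show ?thesis using that d(1) by blast
qed

section \<open>Hurwitz matrices\<close>

lemma matrix_vector_mul_scaleC: "M *v (c *s x) = c *s (M *v x)" for M :: "complex^'n^'m"
  by (simp add: vector_scalar_commute)

text \<open>This is p(M) w. The fold over the coefficients builds a function of the vector, so no
  matrix powers occur and a linear factor of p can be moved onto the vector.\<close>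

definition poly_act :: "complex poly \<Rightarrow> complex^'n^'n \<Rightarrow> complex^'n \<Rightarrow> complex^'n" where
  "poly_act p M = fold_coeffs (\<lambda>a f w. a *s w + f (M *v w)) p (\<lambda>w. 0)"

lemma poly_act_0 [simp]: "poly_act 0 M w = 0"
  by (simp add: poly_act_def)

lemma poly_act_pCons [simp]: "poly_act (pCons a p) M w = a *s w + poly_act p M (M *v w)"
  by (cases "a = 0 \<and> p = 0") (auto simp: poly_act_def)

lemma poly_act_add: "poly_act (p + q) M w = poly_act p M w + poly_act q M w"
  by (induction p q arbitrary: w rule: poly_induct2) (simp_all add: vector_sadd_rdistrib algebra_simps)

lemma poly_act_smult: "poly_act (smult c p) M w = c *s poly_act p M w"
  by (induction p arbitrary: w) (simp_all add: vector_add_ldistrib)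

lemma poly_act_lin: "poly_act p M (v + c *s w) = poly_act p M v + c *s poly_act p M w"
  by (induction p arbitrary: v w)
     (simp_all add: vector_add_ldistrib algebra_simps matrix_vector_mul_scaleC mult.commute)

lemma poly_act_linear_factor:
  "poly_act ([:- c, 1:] * q) M w = poly_act q M (M *v w - c *s w)"
proof -
  have "[:- c, 1:] * q = pCons 0 q + smult (- c) q" by simp
  then show ?thesis using poly_act_lin[of q M "M *v w" "- c" w]
    by (simp only: poly_act_add poly_act_smult poly_act_pCons) simp
qed

lemma poly_act_sum: "poly_act (\<Sum>i\<in>I. f i) M w = (\<Sum>i\<in>I. poly_act (f i) M w)"
  by (induction I rule: infinite_finite_induct) (simp_all add: poly_act_add)

lemma poly_act_monom: "poly_act (monom a i) M w = a *s (((*v) M ^^ i) w)"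
  by (induction i arbitrary: w) (simp_all add: monom_0 monom_Suc funpow_swap1)

lemma poly_act_annihilator:
  fixes M :: "complex^'n^'n"
  shows "\<exists>p. p \<noteq> 0 \<and> poly_act p M v = 0"
proof -
  define it where "it i = ((*v) M ^^ i) v" for i
  \<comment> \<open>The real dimension: a real dependence among the N + 1 iterates from 0 to N is
    enough.\<close>
  define N where "N = DIM(complex^'n)"
  show ?thesis
  proof (cases "inj_on it {..N}")
    \<comment> \<open>If two iterates coincide, the set of iterates is too small for the dimension
      count, but the difference of the two monomials annihilates v.\<close>
    case False
    then obtain i j where ij: "i \<noteq> j" "it i = it j" by (auto simp: inj_on_def)
    let ?p = "monom 1 i + monom (-1) j :: complex poly"
    have "coeff ?p i = 1" using ij by simp
    then have "?p \<noteq> 0" by force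
    moreover have "poly_act ?p M v = 0"
      using ij(2) by (simp add: poly_act_add poly_act_monom flip: it_def)
    ultimately show ?thesis by blast
  next
    case True
    then have "card (it ` {..N}) > DIM(complex^'n)" by (simp add: card_image N_def)
    then have "dependent (it ` {..N})" by (intro dependent_biggerset) simp
    then obtain u where u: "\<exists>w\<in>it ` {..N}. u w \<noteq> 0" "(\<Sum>w\<in>it ` {..N}. u w *\<^sub>R w) = 0"
      by (subst (asm) real_vector.dependent_finite) auto
    let ?p = "\<Sum>i\<le>N. monom (complex_of_real (u (it i))) i"
    have "coeff ?p i = complex_of_real (u (it i))" if "i \<le> N" for i
      using that by (simp add: coeff_sum sum.delta)
    then have "?p \<noteq> 0" using u(1) by (metis (no_types, lifting) atMost_iff coeff_0 imageE of_real_eq_0_iff)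
    moreover have "poly_act ?p M v = (\<Sum>i\<le>N. u (it i) *\<^sub>R it i)"
      by (simp add: poly_act_sum poly_act_monom it_def vec_eq_iff scaleR_conv_of_real[where 'a = complex])
    moreover have "\<dots> = 0" using u(2) True by (simp add: sum.reindex)
    ultimately show ?thesis by metis
  qed
qed

text \<open>Split off a root c of p. Either v is an eigenvector for c, or M v - c v is a nonzero
  element of \<open>V\<close> annihilated by a polynomial of smaller degree.\<close>

lemma poly_act_eigenvector:
  fixes M :: "complex^'n^'n"
  assumes inv: "\<And>w c. w \<in> V \<Longrightarrow> M *v w - c *s w \<in> V"
  shows "p \<noteq> 0 \<Longrightarrow> poly_act p M v = 0 \<Longrightarrow> v \<in> V \<Longrightarrow> v \<noteq> 0
    \<Longrightarrow> \<exists>w\<in>V. w \<noteq> 0 \<and> (\<exists>c. M *v w = c *s w)"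
proof (induction "degree p" arbitrary: p v)
  case 0
  then obtain a where "p = [:a:]" by (metis degree_eq_zeroE)
  with 0 show ?case by simp
next
  case (Suc d)
  then have "\<not> constant (poly p)" by (simp add: constant_degree)
  then obtain c where "poly p c = 0" using fundamental_theorem_of_algebra by blast
  then obtain q where q: "p = [:- c, 1:] * q" by (auto simp: poly_eq_0_iff_dvd dvd_def)
  with Suc have "q \<noteq> 0" by auto
  then have "degree p = Suc (degree q)" using q by (simp add: degree_mult_eq del: mult_pCons_left)
  show ?case
  proof (cases "M *v v - c *s v = 0")
    case True
    then show ?thesis using Suc.prems by auto
  next
    case False
    show ?thesis
      by (rule Suc.hyps(1)[of q "M *v v - c *s v"])
         (use Suc q \<open>q \<noteq> 0\<close> \<open>degree p = _\<close> False inv in \<open>auto simp: poly_act_linear_factor simp del: mult_pCons_left\<close>)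
  qed
qed

lemma invariant_eigenvector:
  fixes M :: "complex^'n^'n"
  assumes "\<And>w c. w \<in> V \<Longrightarrow> M *v w - c *s w \<in> V" "v \<in> V" "v \<noteq> 0"
  obtains w c where "w \<in> V" "w \<noteq> 0" "M *v w = c *s w"
  using poly_act_eigenvector[of V M _ v] poly_act_annihilator[of M v] assms by metis

section \<open>Real matrices acting on complex vectors\<close>

lemma cmat_mul: "cmat (M ** N) = cmat M ** cmat N"
  by (simp add: cmat_def matrix_matrix_mult_def vec_eq_iff)

lemma cmat_add: "cmat (M + N) = cmat M + cmat N"
  by (simp add: cmat_def vec_eq_iff)

lemma cmat_diff: "cmat (M - N) = cmat M - cmat N"
  by (simp add: cmat_def vec_eq_iff)

lemma cmat_minus: "cmat (- M) = - cmat M"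
  by (simp add: cmat_def vec_eq_iff)

lemma cmat_0 [simp]: "cmat 0 = 0"
  by (simp add: cmat_def vec_eq_iff)

lemma cmat_1 [simp]: "cmat (mat 1) = mat 1"
  by (simp add: cmat_def vec_eq_iff mat_def)

lemma cmat_transpose: "cmat (transpose M) = transpose (cmat M)"
  by (simp add: cmat_def vec_eq_iff transpose_def)

lemma cmat_scaleR: "cmat (c *\<^sub>R M) *v x = c *\<^sub>R (cmat M *v x)"
  by (simp add: cmat_def matrix_vector_mult_def vec_eq_iff scaleR_sum_right)
     (simp add: scaleR_conv_of_real mult_ac)

lemmas cmat_algebra = cmat_mul cmat_add cmat_diff cmat_minus cmat_scaleR

lemma cmat_vector_scaleR: "cmat M *v (c *\<^sub>R x) = c *\<^sub>R (cmat M *v x)"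
  by (simp add: cmat_def matrix_vector_mult_def vec_eq_iff scaleR_sum_right)

lemmas cmat_vector_algebra = cmat_algebra matrix_vector_mul_assoc[symmetric]
  matrix_vector_right_distrib matrix_vector_mult_diff_distrib matrix_vector_mult_add_rdistrib
  matrix_vector_mult_diff_rdistrib matrix_vector_mul_uminus matrix_vector_mul_uminus_right
  matrix_vector_mul_scaleC cmat_vector_scaleR

definition vRe :: "complex^'n \<Rightarrow> real^'n" where "vRe x = (\<chi> i. Re (x $ i))"
definition vIm :: "complex^'n \<Rightarrow> real^'n" where "vIm x = (\<chi> i. Im (x $ i))"

text \<open>The inner product on complex vectors is the real one, that is, the real part of the
  Hermitian product. Facts about real quadratic forms thus transfer by applying them to real and
  imaginary parts.\<close>

lemma inner_vRe_vIm: "x \<bullet> y = vRe x \<bullet> vRe y + vIm x \<bullet> vIm y" for x y :: "complex^'n"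
  by (simp add: inner_vec_def inner_complex_def vRe_def vIm_def sum.distrib)

lemma vRe_vIm_cmat: "vRe (cmat M *v x) = M *v vRe x" "vIm (cmat M *v x) = M *v vIm x"
  by (simp_all add: vRe_def vIm_def cmat_def matrix_vector_mult_def vec_eq_iff)

lemma vRe_vIm_0: "vRe x = 0 \<Longrightarrow> vIm x = 0 \<Longrightarrow> x = 0"
  by (simp add: vRe_def vIm_def vec_eq_iff complex_eq_iff)

lemma inner_cmat: "x \<bullet> (cmat M *v y) = (cmat (transpose M) *v x) \<bullet> y"
  by (simp add: inner_vRe_vIm vRe_vIm_cmat inner_matrix_vector[of _ M])

lemma inner_cmat_sym: "sym_mat M \<Longrightarrow> x \<bullet> (cmat M *v y) = (cmat M *v x) \<bullet> y"
  using inner_cmat[of x M y] by (simp add: sym_matD)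

text \<open>The contributions of Im c cancel by symmetry of \<open>M\<close>. This is what isolates
  the real part of an eigenvalue, and what makes imaginary-axis terms disappear from energy
  balances.\<close>

lemma inner_cmat_scale:
  assumes "sym_mat M"
  shows "(cmat M *v x) \<bullet> (c *s x) = Re c * (x \<bullet> (cmat M *v x))"
proof -
  have *: "vRe (c *s x) = Re c *\<^sub>R vRe x - Im c *\<^sub>R vIm x" "vIm (c *s x) = Re c *\<^sub>R vIm x + Im c *\<^sub>R vRe x"
    by (simp_all add: vRe_def vIm_def vec_eq_iff)
  show ?thesis
    using sym_mat_inner[OF assms, of "vIm x" "vRe x"]
    by (simp add: inner_vRe_vIm vRe_vIm_cmat * inner_diff_right inner_add_right algebra_simps inner_commute)
qed

lemma inner_cmat_pd:
  assumes "pd M" "x \<noteq> 0"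
  shows "0 < x \<bullet> (cmat M *v x)"
proof -
  have "0 \<le> vRe x \<bullet> (M *v vRe x)" "0 \<le> vIm x \<bullet> (M *v vIm x)"
    using psdD[OF pd_imp_psd[OF assms(1)]] by auto
  moreover have "vRe x \<noteq> 0 \<or> vIm x \<noteq> 0" using vRe_vIm_0 assms(2) by blast
  ultimately show ?thesis using pdD[OF assms(1)]
    by (auto simp: inner_vRe_vIm vRe_vIm_cmat add_pos_nonneg add_nonneg_pos)
qed

lemma inner_cmat_psd_kernel:
  assumes "psd M" "x \<bullet> (cmat M *v x) = 0"
  shows "cmat M *v x = 0"
proof -
  have "0 \<le> vRe x \<bullet> (M *v vRe x)" "0 \<le> vIm x \<bullet> (M *v vIm x)"
    using psdD[OF assms(1)] by auto
  then have "vRe x \<bullet> (M *v vRe x) = 0" "vIm x \<bullet> (M *v vIm x) = 0"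
    using assms(2) by (simp_all add: inner_vRe_vIm vRe_vIm_cmat)
  then show ?thesis using psd_kernel[OF assms(1)] by (intro vRe_vIm_0) (auto simp: vRe_vIm_cmat)
qed

lemma inner_cmat_lyapunov:
  assumes "sym_mat X"
  shows "x \<bullet> (cmat (M ** X + X ** transpose M) *v x) = 2 * ((cmat X *v x) \<bullet> (cmat (transpose M) *v x))"
  by (simp add: inner_vRe_vIm vRe_vIm_cmat inner_lyapunov[OF assms])

lemma mat_vector_mult: "mat c *v x = c *s x" for x :: "complex^'n"
  by (simp add: mat_def matrix_vector_mult_def vec_eq_iff if_distrib if_distribR cong: if_cong)

text \<open>If the transpose of M - c had a left inverse, transposing it would give a right inverse
  of M - c, which for square matrices is a left inverse and excludes v.\<close>

lemma eigenvalue_transpose: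
  fixes M :: "complex^'n^'n"
  assumes "v \<noteq> 0" "M *v v = c *s v"
  obtains w where "w \<noteq> 0" "transpose M *v w = c *s w"
proof -
  have *: "(N - mat c) *v x = 0 \<longleftrightarrow> N *v x = c *s x" for N :: "complex^'n^'n" and x
    by (simp add: matrix_vector_mult_diff_rdistrib mat_vector_mult)
  have t: "transpose M - mat c = transpose (M - mat c)"
    by (simp add: transpose_def vec_eq_iff mat_def)
  have "\<exists>w. w \<noteq> 0 \<and> (transpose M - mat c) *v w = 0"
  proof (rule ccontr)
    assume "\<not> ?thesis"
    then obtain B where "B ** transpose (M - mat c) = mat 1"
      using matrix_left_invertible_ker[of "transpose M - mat c"] t by auto
    then have "(M - mat c) ** transpose B = mat 1"
      by (metis matrix_transpose_mul transpose_mat transpose_transpose)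
    then have "transpose B ** (M - mat c) = mat 1" using matrix_left_right_inverse by blast
    then have "v = 0" using matrix_left_invertible_ker[of "M - mat c"] *[of M v] assms(2) by blast
    with assms(1) show False by simp
  qed
  with * that show ?thesis by blast
qed

text \<open>At a left eigenvector w the Lyapunov form equals 2 Re(lam) times the positive form of
  \<open>P\<close> at w.\<close>

lemma lyap_imp_hurwitz:
  fixes M :: "real^'n^'n"
  assumes "lyap M"
  shows "hurwitz M"
  unfolding hurwitz_def
proof (intro allI impI)
  fix lam and v :: "complex^'n" assume v: "v \<noteq> 0 \<and> cmat M *v v = lam *s v"
  obtain P where P: "pd P" "pd (- (M ** P + P ** transpose M))" using assms lyap_def by blast
  obtain w where w: "w \<noteq> 0" "cmat (transpose M) *v w = lam *s w"
    using eigenvalue_transpose[of v "cmat M" lam] v by (auto simp: cmat_transpose)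
  have "w \<bullet> (cmat (M ** P + P ** transpose M) *v w) = 2 * (Re lam * (w \<bullet> (cmat P *v w)))"
    using inner_cmat_lyapunov[OF pd_sym[OF P(1)], of w M] inner_cmat_scale[OF pd_sym[OF P(1)], of w lam] w(2)
    by simp
  moreover have "w \<bullet> (cmat (M ** P + P ** transpose M) *v w) < 0"
    using inner_cmat_pd[OF P(2) w(1)]
    by (simp only: cmat_minus matrix_vector_mul_uminus inner_minus_right neg_0_less_iff_less)
  ultimately show "Re lam < 0" using inner_cmat_pd[OF P(1) w(1)]
    by (metis mult_less_0_iff not_less_iff_gr_or_eq zero_less_numeral)
qed

text \<open>Since M U = - U M^T, the range of \<open>U\<close> is invariant under \<open>M\<close>
  and contains an eigenvector v = U y with eigenvalue c. The Lyapunov form at y is zero and also a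
  multiple of Re(c) times the form of \<open>U\<close> at y, which is nonzero because U y
  is.\<close>

lemma psd_lyapunov_kernel_imaginary:
  fixes M U :: "real^'n^'n"
  assumes "psd U" "U \<noteq> 0" "M ** U + U ** transpose M = 0"
  obtains w v where "v \<noteq> 0" "cmat M *v v = (\<i> * complex_of_real w) *s v"
proof -
  define V where "V = range ((*v) (cmat U))"
  have MU: "cmat M ** cmat U = - (cmat U ** cmat (transpose M))"
    using assms(3) by (metis cmat_minus cmat_mul eq_neg_iff_add_eq_0)
  obtain x where x: "U *v x \<noteq> 0" using assms(2) by (metis matrix_eq matrix_vector_mult_0)
  let ?x = "\<chi> i. complex_of_real (x $ i)"
  have "vRe (cmat U *v ?x) = U *v x" unfolding vRe_vIm_cmat by (simp add: vRe_def)
  moreover have "vRe 0 = (0 :: real^'n)" by (simp add: vRe_def vec_eq_iff)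
  ultimately have "cmat U *v ?x \<noteq> 0" using x by metis
  moreover have "cmat U *v ?x \<in> V" by (simp add: V_def)
  moreover have "cmat M *v w - c *s w \<in> V" if w: "w \<in> V" for w c
  proof -
    obtain y where "w = cmat U *v y" using w by (auto simp: V_def)
    then have "cmat M *v w - c *s w = cmat U *v (- (cmat (transpose M) *v y) - c *s y)"
      using MU by (simp add: matrix_vector_mul_assoc matrix_vector_mul_uminus
          matrix_vector_mult_diff_distrib matrix_vector_mul_uminus_right matrix_vector_mul_scaleC)
    then show ?thesis by (simp add: V_def)
  qed
  ultimately obtain v c where v: "v \<in> V" "v \<noteq> 0" "cmat M *v v = c *s v"
    using invariant_eigenvector[of V "cmat M"] by metis
  obtain y where y: "v = cmat U *v y" using v(1) by (auto simp: V_def)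
  have "y \<bullet> (cmat (M ** U + U ** transpose M) *v y) = 2 * ((cmat U *v y) \<bullet> (cmat (transpose M) *v y))"
    by (rule inner_cmat_lyapunov[OF psd_sym[OF assms(1)]])
  then have "0 = v \<bullet> (cmat (transpose M) *v y)" by (simp add: assms(3) y)
  also have "\<dots> = y \<bullet> (cmat M *v v)" by (simp add: inner_cmat[of y M] inner_commute)
  also have "\<dots> = y \<bullet> (cmat U *v (c *s y))" by (simp add: v(3)) (simp add: y matrix_vector_mul_scaleC)
  also have "\<dots> = (cmat U *v y) \<bullet> (c *s y)" by (rule inner_cmat_sym[OF psd_sym[OF assms(1)]])
  also have "\<dots> = Re c * (y \<bullet> (cmat U *v y))" by (rule inner_cmat_scale[OF psd_sym[OF assms(1)]])
  finally have "Re c = 0" using inner_cmat_psd_kernel[OF assms(1), of y] v(2) y by auto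
  then have "c = \<i> * complex_of_real (Im c)" by (simp add: complex_eq_iff)
  with v that show ?thesis by metis
qed

definition noimag :: "real^'n^'n \<Rightarrow> bool" where
  "noimag M \<longleftrightarrow> (\<forall>w v. v \<noteq> 0 \<longrightarrow> cmat M *v v \<noteq> (\<i> * complex_of_real w) *s v)"

text \<open>The normalised Lyapunov certificates of the \<open>f k\<close> converge; if the right-hand side is lost in
  the limit, then \<open>M\<close> has an imaginary eigenvalue.\<close>

lemma lyap_limit:
  fixes M :: "real^'n^'n"
  assumes f: "f \<longlonglongrightarrow> M" and "\<And>k. lyap (f k)" and "noimag M"
  shows "lyap M"
proof -
  have "\<exists>P. pd P \<and> f k ** P + P ** transpose (f k) = - mat 1" for k
    using lyap_normalized[OF assms(2)] by metis
  then obtain P where P: "\<And>k. pd (P k)" "\<And>k. f k ** P k + P k ** transpose (f k) = - mat 1" by metis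
  \<comment> \<open>The certificates may be unbounded, so the pair (P, 1) is rescaled into a compact
    set. A limit with t = 0 corresponds to blow-up and leaves a nonzero solution \<open>V\<close> of
    the homogeneous equation.\<close>
  define s where "s k = 1 / (1 + norm (P k))" for k
  define U where "U k = s k *\<^sub>R P k" for k
  have s: "0 < s k" "s k \<le> 1" "norm (U k) + s k = 1" for k
  proof -
    have "0 < 1 + norm (P k)" by (simp add: add_pos_nonneg)
    then show "0 < s k" "s k \<le> 1" "norm (U k) + s k = 1"
      by (auto simp: s_def U_def field_simps)
  qed
  have "(U k, s k) \<in> cball 0 1 \<times> cball 0 1" for k
    using s[of k] by (simp add: abs_if)
  then have inK: "\<forall>k. (U k, s k) \<in> cball 0 1 \<times> cball 0 1" by blast
  have "seq_compact (cball (0::real^'n^'n) 1 \<times> cball (0::real) 1)"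
    by (intro compact_imp_seq_compact compact_Times) auto
  then obtain l r where r: "strict_mono r" "((\<lambda>k. (U k, s k)) \<circ> r) \<longlonglongrightarrow> l"
    using seq_compactE[OF _ inK] by blast
  obtain V t where l: "l = (V, t)" by force
  have lim: "(\<lambda>k. U (r k)) \<longlonglongrightarrow> V" "(\<lambda>k. s (r k)) \<longlonglongrightarrow> t"
    using tendsto_fst[OF r(2)] tendsto_snd[OF r(2)] by (simp_all add: l o_def)
  have flim: "(\<lambda>k. f (r k)) \<longlonglongrightarrow> M" using LIMSEQ_subseq_LIMSEQ[OF f r(1)] by (simp add: o_def)
  have V: "psd V" using lim(1) by (rule psd_limit) (simp add: U_def s less_imp_le psd_scaleR pd_imp_psd P)
  have "t \<ge> 0" by (rule LIMSEQ_le_const[OF lim(2)]) (use s in \<open>auto intro: less_imp_le\<close>)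
  have "(\<lambda>k. norm (U (r k)) + s (r k)) \<longlonglongrightarrow> norm V + t" by (intro tendsto_intros lim)
  then have nt: "norm V + t = 1" unfolding s by (simp add: LIMSEQ_const_iff)
  have eq: "f (r k) ** U (r k) + U (r k) ** transpose (f (r k)) = - (s (r k) *\<^sub>R mat 1)" for k
    using P(2)[of "r k"] by (simp add: U_def matrix_algebra flip: scaleR_add_right)
  have "(\<lambda>k. f (r k) ** U (r k) + U (r k) ** transpose (f (r k))) \<longlonglongrightarrow> M ** V + V ** transpose M"
    by (intro tendsto_intros flim lim)
  moreover have "(\<lambda>k. - (s (r k) *\<^sub>R (mat 1 :: real^'n^'n))) \<longlonglongrightarrow> - (t *\<^sub>R mat 1)"
    by (intro tendsto_intros lim)
  ultimately have eqV: "M ** V + V ** transpose M = - (t *\<^sub>R mat 1)"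
    unfolding eq using LIMSEQ_unique by blast
  have "t \<noteq> 0"
  proof
    assume "t = 0"
    then have "V \<noteq> 0" "M ** V + V ** transpose M = 0" using nt eqV by auto
    then show False using psd_lyapunov_kernel_imaginary[OF V] \<open>noimag M\<close> unfolding noimag_def by metis
  qed
  with \<open>t \<ge> 0\<close> have "t > 0" by simp
  have "pd V"
  proof (rule psd_imp_pd[OF V])
    fix x assume "V *v x = 0"
    then have "x \<bullet> ((M ** V + V ** transpose M) *v x) = 0" using inner_lyapunov[OF psd_sym[OF V], of x M] by simp
    then show "x = 0" using \<open>t > 0\<close> by (simp add: eqV matrix_vector_mul_uminus scaleR_matrix_vector)
  qed
  moreover have "pd (- (M ** V + V ** transpose M))" using \<open>t > 0\<close> by (simp add: eqV pd_mat)
  ultimately show ?thesis unfolding lyap_def by blast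
qed

text \<open>The good parameters form an open and closed subset of the connected interval. Closedness
  is phrased with sequences to suit the compactness arguments that supply it.\<close>

lemma interval_continuation:
  fixes Q :: "real \<Rightarrow> bool"
  assumes "Q 0"
    and op: "\<And>t. t \<in> {0..1} \<Longrightarrow> Q t \<Longrightarrow> \<exists>d>0. \<forall>s\<in>{0..1}. \<bar>s - t\<bar> < d \<longrightarrow> Q s"
    and cl: "\<And>f t. (\<And>k::nat. f k \<in> {0..1}) \<Longrightarrow> (\<And>k. Q (f k)) \<Longrightarrow> f \<longlonglongrightarrow> t \<Longrightarrow> t \<in> {0..1} \<Longrightarrow> Q t"
  shows "Q 1"
proof -
  define T where "T = {t \<in> {0..1}. Q t}"
  have "openin (top_of_set {0..1}) T"
    unfolding openin_euclidean_subtopology_iff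
    using op by (auto simp: T_def dist_real_def)
  moreover have "closed T"
    unfolding closed_sequential_limits
  proof (intro allI impI)
    fix x l assume x: "(\<forall>n. x n \<in> T) \<and> x \<longlonglongrightarrow> l"
    then have "l \<in> {0..1}"
      using closed_sequentially[of "{0..1::real}" x l] by (auto simp: T_def)
    with x cl[of x l] show "l \<in> T" by (auto simp: T_def)
  qed
  then have "closedin (top_of_set {0..1}) T"
    by (intro closed_subset) (auto simp: T_def)
  moreover have "connected {0..1::real}" by simp
  ultimately have "T = {} \<or> T = {0..1}" unfolding connected_clopen by blast
  with assms(1) have "T = {0..1}" by (auto simp: T_def)
  then have "1 \<in> T" by simp
  then show ?thesis by (simp add: T_def)
qed

text \<open>Continuation along the segment from the negative identity, certified by the identity, to
  \<open>M\<close>. For t > 0 an eigenvalue i w of \<open>F t\<close> would give \<open>M\<close>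
  the eigenvalue (i w + 1 - t) / t, whose real part is not negative.\<close>

theorem hurwitz_imp_lyap:
  fixes M :: "real^'n^'n"
  assumes "hurwitz M"
  shows "lyap M"
proof -
  define F where "F t = t *\<^sub>R M - (1 - t) *\<^sub>R mat 1" for t
  have "lyap (F 1)"
  proof (rule interval_continuation[where Q = "\<lambda>t. lyap (F t)"])
    have "- (- mat 1 ** mat 1 + mat 1 ** transpose (- mat 1)) = 2 *\<^sub>R (mat 1 :: real^'n^'n)"
      by (simp add: transpose_minus scaleR_2)
    then show "lyap (F 0)" unfolding lyap_def F_def
      using pd_mat1 pd_mat[of 2] by (intro exI[of _ "mat 1"]) simp
  next
    fix t assume "lyap (F t)"
    then obtain d where d: "d > 0" "\<And>M'. norm (M' - F t) < d \<Longrightarrow> lyap M'" by (rule lyap_open, blast)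
    have "continuous_on UNIV F" unfolding F_def by (intro continuous_intros)
    then obtain e where "e > 0" "\<And>s. dist s t < e \<Longrightarrow> dist (F s) (F t) < d"
      unfolding continuous_on_iff using d(1) by (metis UNIV_I)
    then show "\<exists>d>0. \<forall>s\<in>{0..1}. \<bar>s - t\<bar> < d \<longrightarrow> lyap (F s)"
      using d(2) by (auto simp: dist_norm)
  next
    fix f :: "nat \<Rightarrow> real" and t assume f: "\<And>k. lyap (F (f k))" "f \<longlonglongrightarrow> t" and t: "t \<in> {0..1}"
    show "lyap (F t)"
    proof (rule lyap_limit[of "\<lambda>k. F (f k)"])
      show "(\<lambda>k. F (f k)) \<longlonglongrightarrow> F t" unfolding F_def by (intro tendsto_intros f)
      show "noimag (F t)"
        unfolding noimag_def
      proof (intro allI impI notI)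
        fix w v assume v: "v \<noteq> 0" and e: "cmat (F t) *v v = (\<i> * complex_of_real w) *s v"
        have e1: "complex_of_real t *s (cmat M *v v) = (\<i> * complex_of_real w + complex_of_real (1 - t)) *s v"
        proof -
          have "cmat (F t) *v v = t *\<^sub>R (cmat M *v v) - (1 - t) *\<^sub>R v"
            by (simp add: F_def cmat_vector_algebra)
          moreover have "t *\<^sub>R x = complex_of_real t *s x" for t and x :: "complex^'n"
            by (simp add: vec_eq_iff scaleR_conv_of_real[where 'a = complex])
          ultimately have "complex_of_real t *s (cmat M *v v) =
            (\<i> * complex_of_real w) *s v + complex_of_real (1 - t) *s v" using e by (simp add: algebra_simps)
          then show ?thesis by (simp add: vector_sadd_rdistrib)
        qed
        show False
        proof (cases "t = 0")
          case True
          then have "(\<i> * complex_of_real w + complex_of_real (1 - t)) *s v = 0"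
            using e1 by (metis of_real_0 vector_smult_lzero)
          with v True have "\<i> * complex_of_real w + 1 = 0" by (simp only: vector_mul_eq_0) simp
          then show False by (simp add: complex_eq_iff)
        next
          case False
          define c where "c = (\<i> * complex_of_real w + complex_of_real (1 - t)) / complex_of_real t"
          have "cmat M *v v = (1 / complex_of_real t) *s (complex_of_real t *s (cmat M *v v))"
            using False by simp
          also have "\<dots> = c *s v" unfolding e1 vector_smult_assoc by (simp only: c_def divide_inverse mult_1_left mult.commute)
          finally have "Re c < 0" using assms v unfolding hurwitz_def by blast
          moreover have "Re c = (1 - t) / t" by (simp add: c_def)
          ultimately show False using t False by (simp add: divide_less_0_iff)
        qed
      qed
    qed (use f in blast)
  qed
  then show ?thesis by (simp add: F_def)
qed

lemma hurwitz_iff_lyap: "hurwitz M \<longleftrightarrow> lyap M"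
  using hurwitz_imp_lyap lyap_imp_hurwitz by blast

lemma hurwitz_noimag: "hurwitz M \<Longrightarrow> noimag M"
  unfolding noimag_def hurwitz_def by force

section \<open>Riccati equations\<close>

text \<open>The norm of a matrix is here the Euclidean norm of its rows' norms and not the operator
  norm; the cardinalities come from crude sums over entries and rows.\<close>

lemma norm_matrix_le:
  fixes X :: "real^'n^'m"
  assumes "\<And>v. norm (X *v v) \<le> C * norm v"
  shows "norm X \<le> real CARD('m) * (real CARD('n) * C)"
proof -
  have "\<bar>X $ i $ j\<bar> \<le> C" for i j
  proof -
    have "X $ i $ j = (X *v axis j 1) $ i"
      by (simp add: matrix_vector_mul_component inner_axis)
    then have "\<bar>X $ i $ j\<bar> \<le> norm (X *v axis j 1)" by (metis component_le_norm_cart)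
    also have "\<dots> \<le> C * norm (axis j 1 :: real^'n)" by (rule assms)
    finally show ?thesis by simp
  qed
  then have "norm (X $ i) \<le> real CARD('n) * C" for i
    using norm_le_l1_cart[of "X $ i"] sum_bounded_above[of UNIV "\<lambda>j. \<bar>X $ i $ j\<bar>" C]
    by (force intro: order_trans)
  then have "(\<Sum>i\<in>UNIV. norm (X $ i)) \<le> real CARD('m) * (real CARD('n) * C)"
    using sum_bounded_above[of UNIV "\<lambda>i. norm (X $ i)"] by force
  moreover have "norm X \<le> (\<Sum>i\<in>UNIV. norm (X $ i))"
    unfolding norm_vec_def by (rule L2_set_le_sum) simp
  ultimately show ?thesis by simp
qed

lemma matrix_vector_bound:
  fixes M :: "real^'n^'m"
  obtains K where "K > 0" "\<And>x. norm (M *v x) \<le> K * norm x"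
proof -
  obtain K where "K > 0" "\<forall>x. norm (M *v x) \<le> norm x * K"
    using bounded_linear.pos_bounded[OF matrix_vector_mul_bounded_linear[of M]] by blast
  then show ?thesis using that[of K] by (simp add: mult.commute)
qed

text \<open>The summand 1 covers a <= b. Otherwise b^2 is at most a b, and the inequality can be
  divided by a.\<close>

lemma quadratic_bound:
  fixes m p q a b :: real
  assumes "m > 0" "p \<ge> 0" "q \<ge> 0" "a \<ge> 0" "b \<ge> 0" "m * a\<^sup>2 \<le> p * a * b + q * b\<^sup>2"
  shows "a \<le> (1 + (p + q) / m) * b"
proof (cases "a \<le> b")
  case True
  moreover have "0 \<le> (p + q) / m * b" using assms by simp
  ultimately show ?thesis by (simp add: algebra_simps)
next
  case False
  then have "b < a" "0 < a" using assms by auto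
  have "q * b\<^sup>2 \<le> q * (a * b)"
    unfolding power2_eq_square using \<open>b < a\<close> assms by (intro mult_left_mono mult_right_mono) auto
  then have "(m * a) * a \<le> ((p + q) * b) * a" using assms(6) by (simp add: power2_eq_square algebra_simps)
  then have "m * a \<le> (p + q) * b" using \<open>0 < a\<close> by (simp add: mult_le_cancel_right)
  then have "a \<le> (p + q) / m * b" using assms(1) by (simp add: field_simps)
  then show ?thesis using assms(5) by (simp add: algebra_simps)
qed

lemma lyap_uminus_pd:
  assumes "pd X"
  shows "lyap (- X)"
proof -
  have "- ((- X) ** mat 1 + mat 1 ** transpose (- X)) = 2 *\<^sub>R X"
    using pd_sym[OF assms] by (simp add: transpose_minus sym_matD scaleR_2)
  then show ?thesis unfolding lyap_def using pd_scaleR[OF _ assms, of 2] pd_mat1 by force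
qed

definition ric :: "real^'n^'n \<Rightarrow> real^'n^'n \<Rightarrow> real^'n^'n \<Rightarrow> real^'n^'n \<Rightarrow> real^'n^'n" where
  "ric A S W X = A ** X + X ** transpose A + X ** S ** X + W"

lemma sym_mat_ric: "sym_mat S \<Longrightarrow> sym_mat W \<Longrightarrow> sym_mat X \<Longrightarrow> sym_mat (ric A S W X)"
  by (simp add: ric_def sym_mat_intros)

text \<open>An exact second-order expansion: the linear term in \<open>D\<close> is the Lyapunov
  operator of A + X S, the quadratic term keeps the sign of \<open>S\<close>.\<close>

lemma ric_add:
  assumes "sym_mat S" "sym_mat X"
  shows "ric A S W' (X + D) = ric A S W X
    + ((A + X ** S) ** D + D ** transpose (A + X ** S)) + D ** S ** D + (W' - W)"
  using assms by (simp add: ric_def matrix_algebra transpose_algebra sym_matD algebra_simps)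

lemma inner_ric:
  assumes "sym_mat X"
  shows "x \<bullet> (ric A S W X *v x) =
    2 * ((X *v x) \<bullet> (transpose A *v x)) + (X *v x) \<bullet> (S *v (X *v x)) + x \<bullet> (W *v x)"
proof -
  have "x \<bullet> ((X ** S ** X) *v x) = (X *v x) \<bullet> (S *v (X *v x))"
    by (simp add: matrix_vector_mul_assoc[symmetric] sym_mat_inner[OF assms])
  then show ?thesis unfolding ric_def using inner_lyapunov[OF assms, of x A]
    by (simp only: matrix_vector_mult_add_rdistrib inner_add_right)
qed

text \<open>With g inverting the Lyapunov operator of A + X S on symmetric matrices, the increment D
  must be a fixed point of D -> - g(D S D + W' - W). This map sends a small ball of symmetric
  matrices into itself, so Brouwer's theorem applies.\<close>

lemma ric_perturb:
  fixes A S W X :: "real^'n^'n"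
  assumes S: "sym_mat S" and X: "sym_mat X" and eq: "ric A S W X = 0" and W: "sym_mat W"
    and stab: "lyap (A + X ** S)" and "e > 0"
  obtains d where "d > 0"
    "\<And>W'. sym_mat W' \<Longrightarrow> norm (W' - W) < d \<Longrightarrow>
      \<exists>X'. sym_mat X' \<and> norm (X' - X) < e \<and> ric A S W' X' = 0"
proof -
  let ?M = "A + X ** S"
  obtain g where g: "linear g"
    "\<And>Q. sym_mat Q \<Longrightarrow> sym_mat (g Q) \<and> ?M ** g Q + g Q ** transpose ?M = Q"
    by (rule lyap_solve[OF stab], blast)
  obtain c where c: "c > 0" "\<And>Q. norm (g Q) \<le> c * norm Q"
    using linear_bounded_pos[OF g(1)] by blast
  obtain K where K: "K > 0" "\<And>(M::real^'n^'n) (N::real^'n^'n). norm (M ** N) \<le> norm M * norm N * K"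
    using bounded_bilinear.pos_bounded[OF bounded_bilinear_matrix_mult] by blast
  \<comment> \<open>A constant for the quadratic term; the 1 keeps it positive even for S =
    0.\<close>
  define k where "k = 1 + K * K * norm S"
  have k: "k > 0" using K(1) by (simp add: k_def add_pos_nonneg)
  have quad: "norm (D ** S ** D) \<le> k * (norm D)\<^sup>2" for D :: "real^'n^'n"
  proof -
    have "norm (D ** S ** D) \<le> norm (D ** S) * norm D * K" by (rule K(2))
    also have "\<dots> \<le> (norm D * norm S * K) * norm D * K"
      by (intro mult_right_mono K(2)) (use K(1) in auto)
    also have "\<dots> = (K * K * norm S) * (norm D)\<^sup>2" by (simp add: power2_eq_square algebra_simps)
    also have "\<dots> \<le> k * (norm D)\<^sup>2" by (intro mult_right_mono) (auto simp: k_def)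
    finally show ?thesis .
  qed
  \<comment> \<open>Chosen so that the quadratic term contributes at most r / 2; the choice of
    \<open>d\<close> below leaves the other r / 2 to the change of W.\<close>
  define r where "r = min (e / 2) (1 / (2 * c * k))"
  have r: "r > 0" "r < e" "c * k * r \<le> 1 / 2"
  proof -
    show "r > 0" "r < e" using \<open>e > 0\<close> c(1) k by (auto simp: r_def)
    have "c * k * r \<le> c * k * (1 / (2 * c * k))"
      using c(1) k by (intro mult_left_mono) (auto simp: r_def)
    then show "c * k * r \<le> 1 / 2" using c(1) k by simp
  qed
  define d where "d = r / (2 * c)"
  have "\<exists>X'. sym_mat X' \<and> norm (X' - X) < e \<and> ric A S W' X' = 0"
    if W': "sym_mat W'" "norm (W' - W) < d" for W'
  proof -
    define f where "f D = - g (D ** S ** D + (W' - W))" for D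
    define T where "T = cball (0::real^'n^'n) r \<inter> {D. sym_mat D}"
    have arg: "sym_mat (D ** S ** D + (W' - W))" if "D \<in> T" for D
      using that by (auto simp: T_def intro!: sym_mat_intros S W W')
    have closed: "closed {D::real^'n^'n. sym_mat D}"
      unfolding sym_mat_def by (intro closed_Collect_eq continuous_intros)
    have "compact T" unfolding T_def by (intro compact_Int_closed closed) auto
    moreover have "convex T"
      unfolding T_def by (intro convex_Int convex_cball) (auto simp: convex_def intro!: sym_mat_intros)
    moreover have "0 \<in> T" using r(1) by (simp add: T_def)
    then have "T \<noteq> {}" by blast
    moreover have "continuous_on T f"
      unfolding f_def by (intro continuous_intros linear_continuous_on_compose[OF _ g(1)])
    moreover have "f \<in> T \<rightarrow> T"
    proof
      fix D assume D: "D \<in> T"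
      then have nD: "norm D \<le> r" by (simp add: T_def)
      have "norm (f D) \<le> c * norm (D ** S ** D + (W' - W))"
        unfolding f_def using c(2) by simp
      also have "\<dots> \<le> c * (k * (norm D)\<^sup>2 + d)"
        using c(1) quad[of D] W'(2) norm_triangle_ineq[of "D ** S ** D" "W' - W"]
        by (intro mult_left_mono) auto
      also have "\<dots> \<le> c * (k * (r * r) + d)"
        unfolding power2_eq_square using c(1) k nD r(1)
        by (intro mult_left_mono add_right_mono mult_mono) auto
      also have "\<dots> = (c * k * r) * r + r / 2" using c(1) by (simp add: d_def algebra_simps)
      also have "\<dots> \<le> 1 / 2 * r + r / 2" using r by (intro add_right_mono mult_right_mono) auto
      finally have "norm (f D) \<le> r" by simp
      moreover have "sym_mat (f D)" using g(2)[OF arg[OF D]] by (simp add: f_def sym_mat_minus)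
      ultimately show "f D \<in> T" by (simp add: T_def)
    qed
    ultimately obtain D where D: "D \<in> T" "f D = D" by (rule brouwer)
    define Q where "Q = D ** S ** D + (W' - W)"
    have "D = - g Q" using D(2) by (simp add: f_def Q_def)
    then have "?M ** D + D ** transpose ?M = - (?M ** g Q + g Q ** transpose ?M)"
      by (simp add: matrix_mul_minus_left matrix_mul_minus_right)
    also have "\<dots> = - Q" using g(2)[OF arg[OF D(1)]] by (simp add: Q_def)
    finally have "?M ** D + D ** transpose ?M = - Q" .
    then have "ric A S W' (X + D) = 0" unfolding ric_add[OF S X, of A W' D W] by (simp only: eq Q_def) simp
    moreover have "sym_mat (X + D)" using D(1) X by (simp add: T_def sym_mat_add)
    moreover have "norm (X + D - X) < e" using D(1) r(2) by (simp add: T_def)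
    ultimately show ?thesis by blast
  qed
  moreover have "d > 0" using r(1) c(1) by (simp add: d_def)
  ultimately show ?thesis using that by blast
qed

text \<open>Expanding around X shows that Y - X has Lyapunov residual - ric(Y) + (Y - X) S (Y - X),
  semidefinite for psd \<open>S\<close>. So a stabilizing solution lies below every symmetric
  solution of the Riccati inequality.\<close>

lemma ric_comparison:
  assumes "psd S" "sym_mat X" "ric A S W X = 0" "lyap (A + X ** S)"
    and "sym_mat Y" "psd (- ric A S W Y)"
  shows "psd (Y - X)"
proof (rule lyap_psd[OF assms(4)])
  let ?M = "A + X ** S" and ?D = "Y - X"
  show D: "sym_mat ?D" using assms by (simp add: sym_mat_diff)
  have "ric A S W Y = (?M ** ?D + ?D ** transpose ?M) + ?D ** S ** ?D"
    using ric_add[OF psd_sym[OF assms(1)] assms(2), of A W ?D W] assms(3) by simp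
  then have "- (?M ** ?D + ?D ** transpose ?M) = - ric A S W Y + ?D ** S ** ?D" by simp
  then show "psd (- (?M ** ?D + ?D ** transpose ?M))"
    using psd_add[OF assms(6) psd_sandwich[OF assms(1) D]] by (simp only:)
qed

lemma ric_unique:
  assumes "psd S" "sym_mat X" "ric A S W X = 0" "lyap (A + X ** S)"
    and "sym_mat Y" "ric A S W Y = 0" "lyap (A + Y ** S)"
  shows "X = Y"
  using psd_antisym[of "Y - X"] ric_comparison[of S X A W Y] ric_comparison[of S Y A W X] assms
  by (simp add: psd_zero)

text \<open>At any v the equation gives m |X v|^2 <= 2 a |X v| |v| + w |v|^2, where m > 0 comes from
  \<open>S\<close>. The bound is uniform in t and uses no sign of X.\<close>

lemma ric_bounded:
  fixes A S W :: "real^'n^'n"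
  assumes "pd S"
  obtains C where "\<And>X t. sym_mat X \<Longrightarrow> 0 \<le> t \<Longrightarrow> t \<le> 1 \<Longrightarrow> ric A S (t *\<^sub>R W) X = 0 \<Longrightarrow> norm X \<le> C"
proof -
  obtain m where m: "m > 0" "\<And>x. m * (x \<bullet> x) \<le> x \<bullet> (S *v x)" by (rule pd_elliptic[OF assms], blast)
  obtain a where a: "a > 0" "\<And>x. norm (transpose A *v x) \<le> a * norm x" by (rule matrix_vector_bound, blast)
  obtain w where w: "w > 0" "\<And>x. norm (W *v x) \<le> w * norm x" by (rule matrix_vector_bound, blast)
  let ?C = "1 + (2 * a + w) / m"
  have "norm X \<le> real CARD('n) * (real CARD('n) * ?C)"
    if X: "sym_mat X" "0 \<le> t" "t \<le> 1" "ric A S (t *\<^sub>R W) X = 0" for X t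
  proof (rule norm_matrix_le)
    fix v
    have "0 = 2 * ((X *v v) \<bullet> (transpose A *v v)) + (X *v v) \<bullet> (S *v (X *v v)) + t * (v \<bullet> (W *v v))"
      using inner_ric[OF X(1), of v A S "t *\<^sub>R W"] X(4) by (simp add: scaleR_matrix_vector)
    moreover have "m * (norm (X *v v))\<^sup>2 \<le> (X *v v) \<bullet> (S *v (X *v v))"
      using m(2)[of "X *v v"] by (simp add: dot_square_norm)
    moreover have "\<bar>(X *v v) \<bullet> (transpose A *v v)\<bar> \<le> norm (X *v v) * (a * norm v)"
      using Cauchy_Schwarz_ineq2 mult_left_mono[OF a(2)] norm_ge_zero order_trans by blast
    moreover have "\<bar>t * (v \<bullet> (W *v v))\<bar> \<le> w * (norm v)\<^sup>2"
    proof -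
      have "\<bar>v \<bullet> (W *v v)\<bar> \<le> norm v * (w * norm v)"
        using Cauchy_Schwarz_ineq2 mult_left_mono[OF w(2)] norm_ge_zero order_trans by blast
      then have "\<bar>t\<bar> * \<bar>v \<bullet> (W *v v)\<bar> \<le> 1 * (norm v * (w * norm v))"
        using X by (intro mult_mono) auto
      then show ?thesis by (simp add: abs_mult power2_eq_square algebra_simps)
    qed
    ultimately have "m * (norm (X *v v))\<^sup>2 \<le> (2 * a) * norm (X *v v) * norm v + w * (norm v)\<^sup>2"
      by (simp add: algebra_simps)
    then show "norm (X *v v) \<le> ?C * norm v" using m a w by (intro quadratic_bound) auto
  qed
  then show ?thesis using that by blast
qed

text \<open>Continuation in the constant term t W, starting from the solution 0, for which A + X S
  is the Hurwitz matrix \<open>A\<close>. The spectral premise is stated for every symmetric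
  solution at every t because it is applied to limits not known to be stabilizing.\<close>

lemma ric_exists:
  fixes A S W :: "real^'n^'n"
  assumes "hurwitz A" "pd S" "sym_mat W"
    and noimag: "\<And>t X. 0 \<le> t \<Longrightarrow> t \<le> 1 \<Longrightarrow> sym_mat X \<Longrightarrow> ric A S (t *\<^sub>R W) X = 0 \<Longrightarrow> noimag (A + X ** S)"
  obtains X where "sym_mat X" "ric A S W X = 0" "lyap (A + X ** S)"
proof -
  define Q where "Q t \<longleftrightarrow> (\<exists>X. sym_mat X \<and> ric A S (t *\<^sub>R W) X = 0 \<and> lyap (A + X ** S))" for t
  have S: "sym_mat S" by (rule pd_sym[OF assms(2)])
  have "Q 1"
  proof (rule interval_continuation)
    show "Q 0" unfolding Q_def
      by (rule exI[of _ 0]) (simp add: ric_def hurwitz_imp_lyap assms(1))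
  next
    fix t assume "Q t"
    then obtain X where X: "sym_mat X" "ric A S (t *\<^sub>R W) X = 0" "lyap (A + X ** S)" by (auto simp: Q_def)
    obtain d where d: "d > 0" "\<And>M. norm (M - (A + X ** S)) < d \<Longrightarrow> lyap M" by (rule lyap_open[OF X(3)], blast)
    have "continuous_on UNIV (\<lambda>X. A + X ** S)" by (intro continuous_intros)
    then obtain e where e: "e > 0" "\<And>Y. dist Y X < e \<Longrightarrow> dist (A + Y ** S) (A + X ** S) < d"
      unfolding continuous_on_iff using d(1) by (metis UNIV_I)
    have "sym_mat (t *\<^sub>R W)" using assms(3) by (rule sym_mat_scaleR)
    from ric_perturb[OF S X(1,2) this X(3) e(1)] obtain d' where d': "d' > 0"
      "\<And>W'. sym_mat W' \<Longrightarrow> norm (W' - t *\<^sub>R W) < d' \<Longrightarrow>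
        \<exists>X'. sym_mat X' \<and> norm (X' - X) < e \<and> ric A S W' X' = 0" by blast
    have "continuous_on UNIV (\<lambda>s. s *\<^sub>R W)" by (intro continuous_intros)
    then obtain d2 where d2: "d2 > 0" "\<And>s. dist s t < d2 \<Longrightarrow> dist (s *\<^sub>R W) (t *\<^sub>R W) < d'"
      unfolding continuous_on_iff using d'(1) by (metis UNIV_I)
    have "Q s" if s: "\<bar>s - t\<bar> < d2" for s
    proof -
      obtain X' where "sym_mat X'" "norm (X' - X) < e" "ric A S (s *\<^sub>R W) X' = 0"
        using d'(2)[OF sym_mat_scaleR[OF assms(3)], of s] d2(2)[of s] s
        unfolding dist_norm real_norm_def by blast
      then show ?thesis unfolding Q_def using e(2)[of X'] d(2) by (auto simp: dist_norm)
    qed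
    then show "\<exists>d>0. \<forall>s\<in>{0..1}. \<bar>s - t\<bar> < d \<longrightarrow> Q s" using d2(1) by blast
  next
    fix f :: "nat \<Rightarrow> real" and t
    assume f: "\<And>k. f k \<in> {0..1}" "\<And>k. Q (f k)" "f \<longlonglongrightarrow> t" and t: "t \<in> {0..1}"
    from f(2) obtain X where X: "\<And>k. sym_mat (X k)" "\<And>k. ric A S (f k *\<^sub>R W) (X k) = 0"
      "\<And>k. lyap (A + X k ** S)" unfolding Q_def by metis
    obtain C where C: "\<And>X t. sym_mat X \<Longrightarrow> 0 \<le> t \<Longrightarrow> t \<le> 1 \<Longrightarrow> ric A S (t *\<^sub>R W) X = 0 \<Longrightarrow> norm X \<le> C"
      by (rule ric_bounded[OF assms(2)], blast)
    have "norm (X k) \<le> C" for k using f(1)[of k] X by (intro C[of "X k" "f k"]) auto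
    then have "bounded (range X)" by (auto simp: bounded_iff)
    then obtain Y r where r: "strict_mono r" "(X \<circ> r) \<longlonglongrightarrow> Y"
      using bounded_imp_convergent_subsequence by blast
    have XY: "(\<lambda>k. X (r k)) \<longlonglongrightarrow> Y" using r(2) by (simp add: o_def)
    have ft: "(\<lambda>k. f (r k)) \<longlonglongrightarrow> t" using LIMSEQ_subseq_LIMSEQ[OF f(3) r(1)] by (simp add: o_def)
    have Y: "sym_mat Y" using XY X(1) by (rule sym_mat_limit)
    have "(\<lambda>k. ric A S (f (r k) *\<^sub>R W) (X (r k))) \<longlonglongrightarrow> ric A S (t *\<^sub>R W) Y"
      unfolding ric_def by (intro tendsto_intros XY ft)
    then have eq: "ric A S (t *\<^sub>R W) Y = 0" by (simp add: X(2) LIMSEQ_const_iff)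
    have "lyap (A + Y ** S)"
    proof (rule lyap_limit)
      show "(\<lambda>k. A + X (r k) ** S) \<longlonglongrightarrow> A + Y ** S" by (intro tendsto_intros XY)
      show "noimag (A + Y ** S)" using t by (intro noimag[OF _ _ Y eq]) auto
    qed (rule X(3))
    with Y eq show "Q t" unfolding Q_def by blast
  qed
  then show ?thesis using that by (auto simp: Q_def)
qed

text \<open>X X = W is a Riccati equation whose linearisation at a positive definite X is the
  Lyapunov operator of the stable matrix -X. Along the segment from the identity to \<open>Q\<close>
  the target stays positive definite, so a limit of roots has trivial kernel.\<close>

lemma pd_square_root:
  fixes Q :: "real^'n^'n"
  assumes "pd Q"
  obtains X where "pd X" "X ** X = Q"
proof -
  define F where "F t = mat 1 + t *\<^sub>R (Q - mat 1)" for t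
  have F: "pd (F t)" if "t \<in> {0..1}" for t
  proof -
    have eq: "F t = (1 - t) *\<^sub>R mat 1 + t *\<^sub>R Q" by (simp add: F_def algebra_simps)
    show ?thesis
    proof (cases "t = 0")
      case False
      then show ?thesis using that unfolding eq
        by (subst add.commute) (intro pd_add_psd pd_scaleR psd_scaleR assms pd_imp_psd[OF pd_mat1]; simp)
    qed (simp add: F_def pd_mat1)
  qed
  have "\<exists>X. pd X \<and> X ** X = F 1"
  proof (rule interval_continuation[where Q = "\<lambda>t. \<exists>X. pd X \<and> X ** X = F t"])
    show "\<exists>X. pd X \<and> X ** X = F 0" by (rule exI[of _ "mat 1"]) (simp add: F_def pd_mat1)
  next
    fix t :: real assume t: "t \<in> {0..1}" and "\<exists>X. pd X \<and> X ** X = F t"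
    then obtain X where X: "pd X" "X ** X = F t" by blast
    have ric: "ric 0 (- mat 1) W Y = W - Y ** Y" for W Y :: "real^'n^'n"
      by (simp add: ric_def matrix_algebra)
    obtain e where e: "e > 0" "\<And>N. sym_mat N \<Longrightarrow> norm (N - X) < e \<Longrightarrow> pd N" by (rule pd_open[OF X(1)], blast)
    have "lyap (0 + X ** (- mat 1))" using lyap_uminus_pd[OF X(1)] by (simp add: matrix_mul_minus_right)
    moreover have "ric 0 (- mat 1) (F t) X = 0" by (simp add: ric X(2))
    moreover have "sym_mat (- mat 1 :: real^'n^'n)" by (simp add: sym_mat_minus)
    ultimately obtain d where d: "d > 0" "\<And>W'. sym_mat W' \<Longrightarrow> norm (W' - F t) < d \<Longrightarrow>
      \<exists>X'. sym_mat X' \<and> norm (X' - X) < e \<and> ric 0 (- mat 1) W' X' = 0"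
      using ric_perturb[of "- mat 1" X 0 "F t" e] pd_sym[OF X(1)] pd_sym[OF F[OF t]] e(1) by metis
    have "continuous_on UNIV F" unfolding F_def by (intro continuous_intros)
    then obtain d2 where d2: "d2 > 0" "\<And>s. dist s t < d2 \<Longrightarrow> dist (F s) (F t) < d"
      unfolding continuous_on_iff using d(1) by (metis UNIV_I)
    have "\<exists>X. pd X \<and> X ** X = F s" if s: "s \<in> {0..1}" "\<bar>s - t\<bar> < d2" for s
    proof -
      obtain X' where "sym_mat X'" "norm (X' - X) < e" "ric 0 (- mat 1) (F s) X' = 0"
        using d(2)[OF pd_sym[OF F[OF s(1)]]] d2(2)[of s] s(2) by (auto simp: dist_norm)
      then show ?thesis using e(2) by (auto simp: ric)
    qed
    then show "\<exists>d>0. \<forall>s\<in>{0..1}. \<bar>s - t\<bar> < d \<longrightarrow> (\<exists>X. pd X \<and> X ** X = F s)" using d2(1) by blast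
  next
    fix f :: "nat \<Rightarrow> real" and t
    assume f: "\<And>k. f k \<in> {0..1}" "\<And>k. \<exists>X. pd X \<and> X ** X = F (f k)" "f \<longlonglongrightarrow> t" and t: "t \<in> {0..1}"
    from f(2) obtain X where X: "\<And>k. pd (X k)" "\<And>k. X k ** X k = F (f k)" by metis
    obtain c where c: "c > 0" "\<And>x. norm ((Q - mat 1) *v x) \<le> c * norm x" by (rule matrix_vector_bound, blast)
    \<comment> \<open>Since |X v|^2 is the form of X X at v, boundedness of the segment
      \<open>F\<close> bounds the roots.\<close>
    have "norm (X k) \<le> real CARD('n) * (real CARD('n) * (1 + c))" for k
    proof (rule norm_matrix_le)
      fix v
      have fk: "0 \<le> f k" "f k \<le> 1" using f(1)[of k] by auto
      have "(norm (X k *v v))\<^sup>2 = v \<bullet> (F (f k) *v v)"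
        unfolding X(2)[symmetric] using sym_mat_inner[OF pd_sym[OF X(1)]]
        by (simp add: matrix_vector_mul_assoc[symmetric] flip: dot_square_norm)
      also have "\<dots> = (norm v)\<^sup>2 + f k * (v \<bullet> ((Q - mat 1) *v v))"
        by (simp add: F_def matrix_vector_mult_add_rdistrib scaleR_matrix_vector inner_add_right dot_square_norm)
      also have "\<dots> \<le> (norm v)\<^sup>2 + 1 * (norm v * (c * norm v))"
      proof -
        have "\<bar>v \<bullet> ((Q - mat 1) *v v)\<bar> \<le> norm v * (c * norm v)"
          using Cauchy_Schwarz_ineq2 mult_left_mono[OF c(2)] norm_ge_zero order_trans by blast
        then have "f k * (v \<bullet> ((Q - mat 1) *v v)) \<le> f k * (norm v * (c * norm v))"
          using fk by (intro mult_left_mono) auto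
        also have "\<dots> \<le> 1 * (norm v * (c * norm v))"
          using fk c(1) by (intro mult_right_mono) auto
        finally show ?thesis by simp
      qed
      also have "\<dots> \<le> ((1 + c) * norm v)\<^sup>2"
        using c(1) by (simp add: power2_eq_square algebra_simps)
      finally show "norm (X k *v v) \<le> (1 + c) * norm v"
        by (rule power2_le_imp_le) (use c(1) in simp)
    qed
    then have "bounded (range X)" by (auto simp: bounded_iff)
    then obtain Y r where r: "strict_mono r" "(X \<circ> r) \<longlonglongrightarrow> Y"
      using bounded_imp_convergent_subsequence by blast
    have XY: "(\<lambda>k. X (r k)) \<longlonglongrightarrow> Y" using r(2) by (simp add: o_def)
    have ft: "(\<lambda>k. f (r k)) \<longlonglongrightarrow> t" using LIMSEQ_subseq_LIMSEQ[OF f(3) r(1)] by (simp add: o_def)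
    have Y: "psd Y" using XY by (rule psd_limit) (rule pd_imp_psd[OF X(1)])
    have "(\<lambda>k. X (r k) ** X (r k)) \<longlonglongrightarrow> Y ** Y" by (intro tendsto_intros XY)
    moreover have "(\<lambda>k. F (f (r k))) \<longlonglongrightarrow> F t" unfolding F_def by (intro tendsto_intros ft)
    ultimately have eq: "Y ** Y = F t" unfolding X(2) using LIMSEQ_unique by blast
    have "pd Y"
    proof (rule psd_imp_pd[OF Y])
      fix x assume "Y *v x = 0"
      then have "F t *v x = 0" unfolding eq[symmetric] by (simp add: matrix_vector_mul_assoc[symmetric])
      then show "x = 0" by (rule pd_kernel[OF F[OF t]])
    qed
    with eq show "\<exists>X. pd X \<and> X ** X = F t" by blast
  qed
  then show ?thesis using that by (auto simp: F_def)
qed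

text \<open>S - T solves the homogeneous Lyapunov equation of the stable matrix -(S + T): the mixed
  products cancel and the squares agree.\<close>

lemma psd_square_root_unique:
  fixes S T :: "real^'n^'n"
  assumes "pd S" "psd T" "S ** S = T ** T"
  shows "S = T"
proof -
  have ST: "pd (S + T)" using assms by (intro pd_add_psd)
  have lyap: "lyap (- (S + T))" by (rule lyap_uminus_pd[OF ST])
  have "S - T = 0"
  proof (rule lyap_unique[OF lyap])
    show "sym_mat (S - T)" using pd_sym[OF assms(1)] psd_sym[OF assms(2)] by (rule sym_mat_diff)
    show "- (S + T) ** (S - T) + (S - T) ** transpose (- (S + T)) = 0"
      using pd_sym[OF assms(1)] psd_sym[OF assms(2)] assms(3)
      by (simp add: matrix_algebra transpose_algebra sym_matD)
  qed
  then show ?thesis by simp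
qed

lemma msqrt_pd:
  assumes "pd Q"
  shows "sym_mat (msqrt Q)" "msqrt Q ** msqrt Q = Q"
proof -
  obtain X where X: "pd X" "X ** X = Q" by (rule pd_square_root[OF assms], blast)
  have "msqrt Q = X"
    unfolding msqrt_def
  proof (rule the_equality)
    show "psd X \<and> X ** X = Q" using X pd_imp_psd by blast
    show "S = X" if "psd S \<and> S ** S = Q" for S
      using psd_square_root_unique[OF X(1), of S] that X(2) by simp
  qed
  then have "psd (msqrt Q) \<and> msqrt Q ** msqrt Q = Q" using X pd_imp_psd by simp
  then show "sym_mat (msqrt Q)" "msqrt Q ** msqrt Q = Q" by (auto simp: psd_def)
qed

lemma trace_psd_nonneg:
  assumes "psd N"
  shows "trace N \<ge> 0"
  unfolding trace_def
proof (rule sum_nonneg)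
  fix i
  have "N $ i $ i = axis i 1 \<bullet> (N *v axis i 1)"
    by (simp add: inner_axis' matrix_vector_mul_component inner_axis)
  then show "0 \<le> N $ i $ i" using psdD[OF assms] by metis
qed

lemma trace_scaleR: "trace (c *\<^sub>R N) = c * trace N" for N :: "real^'n^'n"
  by (simp add: trace_def sum_distrib_left)

text \<open>Regularise D to e I + D = E E; then trace (N E E) = trace (E N E) is nonnegative, and e
  tends to 0.\<close>

lemma trace_psd_mul_nonneg:
  assumes "psd N" "psd D"
  shows "trace (N ** D) \<ge> 0"
proof (rule field_le_epsilon)
  have pos: "trace (N ** D) + e * trace N \<ge> 0" if "e > 0" for e
  proof -
    have "pd (e *\<^sub>R mat 1 + D)" using that assms by (intro pd_add_psd pd_mat)
    then obtain E where E: "pd E" "E ** E = e *\<^sub>R mat 1 + D" by (rule pd_square_root, blast)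
    have "0 \<le> trace (E ** N ** E)" using psd_sandwich[OF assms(1) pd_sym[OF E(1)]] by (rule trace_psd_nonneg)
    also have "\<dots> = trace (N ** (E ** E))" by (metis matrix_mul_assoc trace_mul_sym)
    also have "\<dots> = trace (N ** D) + e * trace N"
      by (simp add: E(2) matrix_add_ldistrib scaleR_matrix_mul_right trace_add trace_scaleR)
    finally show ?thesis .
  qed
  fix e :: real assume "e > 0"
  have "trace N \<ge> 0" using assms(1) by (rule trace_psd_nonneg)
  have "e / (1 + trace N) * trace N \<le> e"
    using \<open>e > 0\<close> \<open>trace N \<ge> 0\<close> by (simp add: field_simps)
  with pos[of "e / (1 + trace N)"] \<open>e > 0\<close> \<open>trace N \<ge> 0\<close> show "0 \<le> trace (N ** D) + e"
    by (smt (verit) divide_pos_pos)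
qed

section \<open>The H-infinity norm\<close>

lemma pd_minus_small:
  fixes N R :: "real^'n^'n"
  assumes "pd N" "sym_mat R"
  obtains e where "e > 0" "pd (N - e *\<^sub>R R)"
proof -
  obtain d where d: "d > 0" "\<And>N'. sym_mat N' \<Longrightarrow> norm (N' - N) < d \<Longrightarrow> pd N'"
    by (rule pd_open[OF assms(1)], blast)
  define e where "e = d / (1 + norm R)"
  have pos: "1 + norm R > 0" by (simp add: add_pos_nonneg)
  then have "e > 0" using d(1) by (simp add: e_def)
  have "e * norm R < d" using pos d(1) by (simp add: e_def field_simps)
  then have "norm ((N - e *\<^sub>R R) - N) < d" using \<open>e > 0\<close> by simp
  moreover have "sym_mat (N - e *\<^sub>R R)" using assms pd_sym by (intro sym_mat_intros)
  ultimately have "pd (N - e *\<^sub>R R)" using d(2) by blast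
  with \<open>e > 0\<close> show ?thesis using that by blast
qed

lemma pd_sandwich:
  assumes "pd S" "pd X"
  shows "pd (X ** S ** X)"
proof (rule psd_imp_pd)
  show "psd (X ** S ** X)" using assms by (intro psd_sandwich pd_imp_psd pd_sym)
  fix x assume "(X ** S ** X) *v x = 0"
  then have "X *v (S *v (X *v x)) = 0" by (simp add: matrix_vector_mul_assoc matrix_mul_assoc)
  then show "x = 0" using pd_kernel[OF assms(1)] pd_kernel[OF assms(2)] by blast
qed

lemma sum_UNIV_Plus:
  "(\<Sum>i\<in>UNIV. f i) = (\<Sum>a\<in>UNIV. f (Inl a)) + (\<Sum>b\<in>UNIV. f (Inr b))"
  for f :: "'a::finite + 'b::finite \<Rightarrow> 'c::comm_monoid_add"
  by (simp add: UNIV_Plus_UNIV[symmetric] sum.Plus del: UNIV_Plus_UNIV)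

text \<open>This factorisation of S_K ties the gain of the transfer function to the quadratic term
  of the Riccati equation.\<close>

lemma out_mat_gram:
  assumes "pd Qi" "pd Ri"
  shows "transpose (out_mat Qi Ri K) ** out_mat Qi Ri K = SK Qi Ri K"
proof -
  have "transpose (out_mat Qi Ri K) ** out_mat Qi Ri K =
    transpose (msqrt Qi) ** msqrt Qi + transpose (msqrt Ri ** K) ** (msqrt Ri ** K)"
  proof -
    have "(transpose (out_mat Qi Ri K) ** out_mat Qi Ri K) $ i $ j =
      (transpose (msqrt Qi) ** msqrt Qi) $ i $ j + (transpose (msqrt Ri ** K) ** (msqrt Ri ** K)) $ i $ j" for i j
      unfolding matrix_matrix_mult_def[of "transpose (out_mat Qi Ri K)"]
        matrix_matrix_mult_def[of "transpose (msqrt Qi)"] matrix_matrix_mult_def[of "transpose (msqrt Ri ** K)"]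
      by (simp add: sum_UNIV_Plus transpose_def out_mat_def)
    then show ?thesis by (simp add: vec_eq_iff)
  qed
  also have "\<dots> = SK Qi Ri K"
    using msqrt_pd[OF assms(1)] msqrt_pd[OF assms(2)]
    by (simp add: SK_def matrix_transpose_mul sym_matD) (metis matrix_mul_assoc)
  finally show ?thesis .
qed

lemma SK_inner: "x \<bullet> (SK Qi Ri K *v x) = x \<bullet> (Qi *v x) + (K *v x) \<bullet> (Ri *v (K *v x))"
  by (simp add: SK_def matrix_vector_algebra inner_add_right inner_matrix_vector[of x "transpose K"])

lemma pd_SK:
  assumes "pd Qi" "pd Ri"
  shows "pd (SK Qi Ri K)"
  unfolding SK_def
  using psd_congruence[OF pd_imp_psd[OF assms(2)], of "transpose K"] assms(1) by (intro pd_add_psd) auto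

lemma norm_cmat_sq: "(norm (cmat C *v x))\<^sup>2 = x \<bullet> (cmat (transpose C ** C) *v x)"
  by (simp add: cmat_mul matrix_vector_mul_assoc[symmetric] inner_cmat[of x "transpose C"] flip: dot_square_norm)

lemma inner_scaleC: "(c *s x) \<bullet> y = x \<bullet> (cnj c *s y)" for x y :: "complex^'n"
  by (simp add: inner_vec_def inner_complex_def algebra_simps)

text \<open>\<open>y\<close> is the state response to the input v at frequency w. Later arguments
  use only its linear equation, not the inverse matrix.\<close>

lemma Tinf_solution:
  assumes "noimag (closed_loop A B K)"
  obtains y where
    "(\<i> * complex_of_real w) *s y - cmat (closed_loop A B K) *v y = cmat Bw *v v"
    "Tinf A B Bw Qi Ri K (\<i> * complex_of_real w) *v v = cmat (out_mat Qi Ri K) *v y"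
proof -
  let ?R = "mat (\<i> * complex_of_real w) - cmat (closed_loop A B K)"
  have "\<forall>x. ?R *v x = 0 \<longrightarrow> x = 0"
    using assms[unfolded noimag_def]
    by (auto simp: matrix_vector_mult_diff_rdistrib mat_vector_mult) metis
  then have "invertible ?R"
    using matrix_left_invertible_ker[of ?R] matrix_left_right_inverse unfolding invertible_def by metis
  then have inv: "?R ** matrix_inv ?R = mat 1" by (rule matrix_inv_mul)
  let ?y = "matrix_inv ?R *v (cmat Bw *v v)"
  have "?R *v ?y = cmat Bw *v v" by (simp add: matrix_vector_mul_assoc[of ?R] inv)
  then show ?thesis
    using that[of ?y] by (simp add: matrix_vector_mult_diff_rdistrib mat_vector_mult Tinf_def matrix_vector_mul_assoc[symmetric])
qed

text \<open>One direction of the bounded real lemma, with a margin. Pairing the state equation with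
  p = X^-1 y gives an energy balance in which N, X S X and W add up to 2 (b . v). As N dominates m X
  S X at every frequency, the gain is at most beta / sqrt(1 + m), strictly below beta even after
  taking the supremum.\<close>

lemma Tinf_bound:
  assumes weights: "pd Qi" "pd Ri" and "beta > 0" and X: "pd X"
    and strict: "pd (- ric (closed_loop A B K) (inverse (beta\<^sup>2) *\<^sub>R SK Qi Ri K) (Bw ** transpose Bw) X)"
    and "noimag (closed_loop A B K)"
  obtains c where "0 \<le> c" "c < beta"
    "\<And>w v. norm (Tinf A B Bw Qi Ri K (\<i> * complex_of_real w) *v v) \<le> c * norm v"
proof -
  let ?A = "closed_loop A B K" and ?C = "out_mat Qi Ri K"
  let ?S = "inverse (beta\<^sup>2) *\<^sub>R SK Qi Ri K"
  define N where "N = - ric ?A ?S (Bw ** transpose Bw) X"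
  have N: "pd N" using strict by (simp only: N_def)
  have S: "pd ?S" using assms by (intro pd_scaleR pd_SK) auto
  obtain m where m: "m > 0" "\<And>x. m * (x \<bullet> ((X ** ?S ** X) *v x)) \<le> x \<bullet> (N *v x)"
    by (rule pd_dominates[OF N pd_sandwich[OF S X]], blast)
  have mC: "m * (p \<bullet> (cmat (X ** ?S ** X) *v p)) \<le> p \<bullet> (cmat N *v p)" for p
    using m(2)[of "vRe p"] m(2)[of "vIm p"] by (simp add: inner_vRe_vIm vRe_vIm_cmat algebra_simps)
  define c where "c = beta / sqrt (1 + m)"
  have c: "0 \<le> c" "c < beta" "c\<^sup>2 * (1 + m) = beta\<^sup>2"
    using \<open>beta > 0\<close> m(1) by (auto simp: c_def power_divide divide_less_eq)
  have "norm (Tinf A B Bw Qi Ri K (\<i> * complex_of_real w) *v v) \<le> c * norm v" for w v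
  proof -
    obtain y where y: "(\<i> * complex_of_real w) *s y - cmat ?A *v y = cmat Bw *v v"
      "Tinf A B Bw Qi Ri K (\<i> * complex_of_real w) *v v = cmat ?C *v y"
      by (rule Tinf_solution[OF assms(6)], blast)
    define p where "p = cmat (matrix_inv X) *v y"
    have "cmat X ** cmat (matrix_inv X) = mat 1"
      using matrix_inv_mul(1)[OF pd_invertible[OF X]] by (metis cmat_1 cmat_mul)
    then have yp: "y = cmat X *v p" by (simp add: p_def matrix_vector_mul_assoc)
    define b where "b = cmat (transpose Bw) *v p"
    have "p \<bullet> (cmat Bw *v v) = b \<bullet> v" by (simp add: inner_cmat b_def)
    moreover have "p \<bullet> ((\<i> * complex_of_real w) *s y) = 0"
    proof -
      have "p \<bullet> ((\<i> * complex_of_real w) *s y) = p \<bullet> (cmat X *v ((\<i> * complex_of_real w) *s p))"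
        by (simp add: yp matrix_vector_mul_scaleC)
      also have "\<dots> = 0"
        by (simp add: inner_cmat_sym[OF pd_sym[OF X]] inner_cmat_scale[OF pd_sym[OF X]])
      finally show ?thesis .
    qed
    moreover have "p \<bullet> (cmat ?A *v y) = (1/2) * (p \<bullet> (cmat (?A ** X + X ** transpose ?A) *v p))"
      by (simp only: inner_cmat_lyapunov[OF pd_sym[OF X]]) (simp add: inner_cmat[of p ?A] yp inner_commute)
    ultimately have e1: "- (p \<bullet> (cmat (?A ** X + X ** transpose ?A) *v p)) = 2 * (b \<bullet> v)"
      unfolding y(1)[symmetric] by (simp add: inner_diff_right)
    have "- (?A ** X + X ** transpose ?A) = N + X ** ?S ** X + Bw ** transpose Bw"
      by (simp add: N_def ric_def)
    then have "p \<bullet> (cmat (- (?A ** X + X ** transpose ?A)) *v p) =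
      p \<bullet> (cmat N *v p) + p \<bullet> (cmat (X ** ?S ** X) *v p) + p \<bullet> (cmat (Bw ** transpose Bw) *v p)"
      by (simp only: cmat_add matrix_vector_mult_add_rdistrib inner_add_right)
    then have e2: "- (p \<bullet> (cmat (?A ** X + X ** transpose ?A) *v p)) =
      p \<bullet> (cmat N *v p) + p \<bullet> (cmat (X ** ?S ** X) *v p) + p \<bullet> (cmat (Bw ** transpose Bw) *v p)"
      by (simp only: cmat_minus matrix_vector_mul_uminus inner_minus_right)
    have e3: "p \<bullet> (cmat (Bw ** transpose Bw) *v p) = (norm b)\<^sup>2"
      using norm_cmat_sq[of "transpose Bw" p] by (simp add: b_def)
    have e4: "p \<bullet> (cmat (X ** ?S ** X) *v p) = inverse (beta\<^sup>2) * (norm (cmat ?C *v y))\<^sup>2"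
      unfolding norm_cmat_sq out_mat_gram[OF weights] yp
      using inner_cmat_sym[OF pd_sym[OF X]]
      by (simp only: cmat_mul cmat_scaleR matrix_vector_mul_assoc[symmetric] inner_scaleR_right) 
    \<comment> \<open>Completing the square: the |b|^2 on the right cancels the contribution of W in
      the balance.\<close>
    have "2 * (b \<bullet> v) \<le> (norm b)\<^sup>2 + (norm v)\<^sup>2"
      using norm_cauchy_schwarz[of b v] sum_squares_bound[of "norm b" "norm v"] by simp
    with e1 e2 e3 mC[of p] have "(1 + m) * (p \<bullet> (cmat (X ** ?S ** X) *v p)) \<le> (norm v)\<^sup>2"
      by (simp add: algebra_simps)
    then have "(1 + m) * (norm (cmat ?C *v y))\<^sup>2 \<le> beta\<^sup>2 * (norm v)\<^sup>2"
      unfolding e4 using \<open>beta > 0\<close> by (simp add: field_simps)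
    also have "\<dots> = (1 + m) * (c * norm v)\<^sup>2" by (simp add: power_mult_distrib flip: c(3))
    finally have "(norm (cmat ?C *v y))\<^sup>2 \<le> (c * norm v)\<^sup>2" using m(1) by simp
    then show ?thesis unfolding y(2) by (rule power2_le_imp_le) (use c(1) in simp)
  qed
  with c that show ?thesis by blast
qed

text \<open>The supremum in \<open>hinf_norm\<close> is one of reals and informative only for a
  bounded range. Every stable closed loop satisfies the strict Riccati inequality for a sufficiently
  large artificial level, and \<open>Tinf_bound\<close> does the rest.\<close>

lemma Tinf_bdd_above:
  assumes weights: "pd Qi" "pd Ri" and stab: "lyap (closed_loop A B K)"
  shows "bdd_above (range (\<lambda>w::real. onorm (\<lambda>v. Tinf A B Bw Qi Ri K (\<i> * complex_of_real w) *v v)))"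
proof -
  let ?A = "closed_loop A B K" and ?W = "Bw ** transpose Bw" and ?S = "SK Qi Ri K"
  have W: "sym_mat ?W" by (simp add: sym_mat_def matrix_transpose_mul)
  obtain P where P: "pd P" "?A ** P + P ** transpose ?A = - mat 1" by (rule lyap_normalized[OF stab], blast)
  obtain e where e: "e > 0" "pd (mat 1 - e *\<^sub>R ?W)" by (rule pd_minus_small[OF pd_mat1 W], blast)
  \<comment> \<open>With this scaling the Lyapunov residual of \<open>X\<close> is -I / e, enough to
    dominate W.\<close>
  define X where "X = inverse e *\<^sub>R P"
  have X: "pd X" using e P by (simp add: X_def pd_scaleR)
  have "inverse e *\<^sub>R (mat 1 - e *\<^sub>R ?W) = inverse e *\<^sub>R mat 1 - ?W"
    using e(1) by (simp add: scaleR_diff_right)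
  then have pd1: "pd (inverse e *\<^sub>R mat 1 - ?W)" using pd_scaleR[OF _ e(2), of "inverse e"] e(1) by simp
  have "sym_mat (X ** ?S ** X)" by (intro sym_mat_sandwich pd_sym pd_SK weights X)
  then obtain d where d: "d > 0" "pd (inverse e *\<^sub>R mat 1 - ?W - d *\<^sub>R (X ** ?S ** X))"
    by (rule pd_minus_small[OF pd1], blast)
  \<comment> \<open>\<open>d\<close> takes the role of beta^-2 and is small enough for the X S X
    term to fit into the remaining margin.\<close>
  define beta where "beta = 1 / sqrt d"
  have beta: "beta > 0" "inverse (beta\<^sup>2) = d" using d(1) by (auto simp: beta_def power_divide)
  have "?A ** X + X ** transpose ?A = inverse e *\<^sub>R (- mat 1)"
    unfolding P(2)[symmetric] by (simp add: X_def matrix_algebra scaleR_add_right)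
  then have "- ric ?A (inverse (beta\<^sup>2) *\<^sub>R ?S) ?W X = inverse e *\<^sub>R mat 1 - ?W - d *\<^sub>R (X ** ?S ** X)"
    unfolding ric_def beta(2) by (simp add: matrix_algebra)
  then have "pd (- ric ?A (inverse (beta\<^sup>2) *\<^sub>R ?S) ?W X)" using d(2) by (simp only:)
  then obtain c where c: "0 \<le> c"
    "\<And>w v. norm (Tinf A B Bw Qi Ri K (\<i> * complex_of_real w) *v v) \<le> c * norm v"
    by (rule Tinf_bound[OF weights beta(1) X _ hurwitz_noimag[OF lyap_imp_hurwitz[OF stab]]], blast)
  have "onorm (\<lambda>v. Tinf A B Bw Qi Ri K (\<i> * complex_of_real w) *v v) \<le> c" for w
    by (rule onorm_bound[OF c])
  then show ?thesis by (intro bdd_aboveI[of _ c]) auto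
qed

lemma Tinf_le_hinf_norm:
  assumes "pd Qi" "pd Ri" "lyap (closed_loop A B K)"
  shows "norm (Tinf A B Bw Qi Ri K (\<i> * complex_of_real w) *v v) \<le> hinf_norm A B Bw Qi Ri K * norm v"
proof -
  let ?T = "Tinf A B Bw Qi Ri K (\<i> * complex_of_real w)"
  have "onorm (\<lambda>v. ?T *v v) \<le> hinf_norm A B Bw Qi Ri K"
    unfolding hinf_norm_def by (rule cSUP_upper[OF UNIV_I Tinf_bdd_above[OF assms]])
  moreover have "norm (?T *v v) \<le> onorm (\<lambda>v. ?T *v v) * norm v"
    by (rule onorm) (rule matrix_vector_mul_bounded_linear)
  ultimately show ?thesis by (meson mult_right_mono norm_ge_zero order_trans)
qed

text \<open>X itself certifies stability of the closed loop, because W and X S X are semidefinite;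
  the frequency bound then applies.\<close>

lemma strict_riccati_imp_Kbeta:
  assumes weights: "pd Qi" "pd Ri" and "beta > 0" and X: "pd X"
    and strict: "pd (- ric (closed_loop A B K) (inverse (beta\<^sup>2) *\<^sub>R SK Qi Ri K) (Bw ** transpose Bw) X)"
  shows "K \<in> Kbeta A B Bw Qi Ri beta"
proof -
  let ?A = "closed_loop A B K" and ?S = "inverse (beta\<^sup>2) *\<^sub>R SK Qi Ri K" and ?W = "Bw ** transpose Bw"
  have "psd ?W" using psd_congruence[OF pd_imp_psd[OF pd_mat1], of Bw] by simp
  moreover have "psd (X ** ?S ** X)"
    using assms by (intro psd_sandwich psd_scaleR pd_imp_psd[OF pd_SK] pd_sym) auto
  ultimately have "pd (- ric ?A ?S ?W X + (X ** ?S ** X + ?W))" using strict by (intro pd_add_psd psd_add)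
  moreover have "- ric ?A ?S ?W X + (X ** ?S ** X + ?W) = - (?A ** X + X ** transpose ?A)"
    by (simp add: ric_def)
  ultimately have "lyap ?A" unfolding lyap_def using X by metis
  then have hurwitz: "hurwitz ?A" by (rule lyap_imp_hurwitz)
  obtain c where c: "0 \<le> c" "c < beta"
    "\<And>w v. norm (Tinf A B Bw Qi Ri K (\<i> * complex_of_real w) *v v) \<le> c * norm v"
    by (rule Tinf_bound[OF assms hurwitz_noimag[OF hurwitz]], blast)
  have "hinf_norm A B Bw Qi Ri K \<le> c"
    unfolding hinf_norm_def by (intro cSUP_least onorm_bound c) auto
  with c hurwitz show ?thesis by (simp add: Kbeta_def stabilizing_set_def)
qed

text \<open>A left eigenvector of \<open>A + X ** S\<close> on the imaginary axis would be an input direction along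
  which the transfer function has gain at least \<open>beta\<close>.\<close>

lemma hinf_norm_imp_noimag:
  assumes weights: "pd Qi" "pd Ri" and "beta > 0"
    and stab: "hurwitz (closed_loop A B K)" and hinf: "hinf_norm A B Bw Qi Ri K < beta"
    and t: "0 \<le> t" "t \<le> 1" and X: "sym_mat X"
    and eq: "ric (closed_loop A B K) (inverse (beta\<^sup>2) *\<^sub>R SK Qi Ri K) (t *\<^sub>R (Bw ** transpose Bw)) X = 0"
  shows "noimag (closed_loop A B K + X ** (inverse (beta\<^sup>2) *\<^sub>R SK Qi Ri K))"
  unfolding noimag_def
proof (intro allI impI notI)
  let ?A = "closed_loop A B K" and ?S = "inverse (beta\<^sup>2) *\<^sub>R SK Qi Ri K" and ?C = "out_mat Qi Ri K"
  let ?h = "hinf_norm A B Bw Qi Ri K" and ?b = "inverse (beta\<^sup>2)"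
  fix w v' assume "v' \<noteq> 0" "cmat (?A + X ** ?S) *v v' = (\<i> * complex_of_real w) *s v'"
  then obtain x where x: "x \<noteq> 0" "transpose (cmat (?A + X ** ?S)) *v x = (\<i> * complex_of_real w) *s x"
    by (rule eigenvalue_transpose)
  have S: "pd ?S" using assms by (intro pd_scaleR pd_SK) auto
  have lyap: "lyap ?A" using stab by (rule hurwitz_imp_lyap)
  define p where "p = cmat X *v x"
  define u where "u = cmat ?C *v p"
  define v where "v = cmat (transpose Bw) *v x"
  have "transpose (?A + X ** ?S) = transpose ?A + ?S ** X"
    by (simp only: transpose_add matrix_transpose_mul sym_matD[OF X] sym_matD[OF pd_sym[OF S]])
  then have Ax: "cmat (transpose ?A) *v x = (\<i> * complex_of_real w) *s x - cmat ?S *v p"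
    using x(2) unfolding cmat_transpose[symmetric] p_def
    by (simp add: cmat_add cmat_mul matrix_vector_mult_add_rdistrib matrix_vector_mul_assoc[symmetric] algebra_simps)
  have Sp: "cmat ?S *v p = ?b *\<^sub>R (cmat (transpose ?C) *v u)"
    unfolding cmat_scaleR out_mat_gram[OF weights, symmetric] u_def
    by (simp add: cmat_mul matrix_vector_mul_assoc[symmetric])
  have pSp: "p \<bullet> (cmat ?S *v p) = ?b * (norm u)\<^sup>2"
    unfolding Sp by (simp add: inner_cmat[of p "transpose ?C"] flip: u_def dot_square_norm)
  \<comment> \<open>The frequency is -w because moving a scalar across the inner product conjugates
    it.\<close>
  obtain y where y: "(\<i> * complex_of_real (- w)) *s y - cmat ?A *v y = cmat Bw *v v"
      "Tinf A B Bw Qi Ri K (\<i> * complex_of_real (- w)) *v v = cmat ?C *v y"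
    by (rule Tinf_solution[OF hurwitz_noimag[OF stab]], blast)
  \<comment> \<open>In the pairing of B_w v with x the frequency terms and A cancel, leaving only
    outputs. This yields |v| <= beta^-2 h |u|, with h the H-infinity norm.\<close>
  have "(norm v)\<^sup>2 = (cmat Bw *v v) \<bullet> x"
    unfolding v_def inner_commute[of _ x] by (simp add: inner_cmat[of x Bw] flip: dot_square_norm)
  also have "\<dots> = y \<bullet> ((\<i> * complex_of_real w) *s x - cmat (transpose ?A) *v x)"
    unfolding y(1)[symmetric] inner_diff_left inner_scaleC
    by (simp add: inner_cmat[of x ?A] inner_cmat[of y "transpose ?A"] inner_diff_right)
  also have "\<dots> = ?b * ((cmat ?C *v y) \<bullet> u)"
    unfolding Ax Sp by (simp add: inner_cmat[of y "transpose ?C"])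
  also have "\<dots> \<le> ?b * (?h * norm v * norm u)"
  proof (rule mult_left_mono)
    have "(cmat ?C *v y) \<bullet> u \<le> norm (cmat ?C *v y) * norm u" by (rule norm_cauchy_schwarz)
    also have "\<dots> \<le> (?h * norm v) * norm u"
      using Tinf_le_hinf_norm[OF weights lyap, of Bw "- w" v] unfolding y(2)
      by (rule mult_right_mono) simp
    finally show "(cmat ?C *v y) \<bullet> u \<le> ?h * norm v * norm u" .
  qed simp
  finally have "norm v * norm v \<le> (?b * (?h * norm u)) * norm v" by (simp add: power2_eq_square algebra_simps)
  then have v: "norm v \<le> ?b * (?h * norm u)" if "v \<noteq> 0"
    using that by (simp add: mult_le_cancel_right)
  \<comment> \<open>The Riccati equation at x gives the converse estimate, beta^-2 |u|^2 = t |v|^2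
    with t <= 1. Together the two force beta <= h unless u = 0.\<close>
  have "x \<bullet> (cmat (ric ?A ?S (t *\<^sub>R (Bw ** transpose Bw)) X) *v x) =
    2 * (p \<bullet> (cmat (transpose ?A) *v x)) + p \<bullet> (cmat ?S *v p) + t * (norm v)\<^sup>2"
  proof -
    have "x \<bullet> (cmat (X ** ?S ** X) *v x) = p \<bullet> (cmat ?S *v p)"
      by (simp only: cmat_mul matrix_vector_mul_assoc[symmetric] inner_cmat_sym[OF X, of x] p_def)
    moreover have "x \<bullet> (cmat (Bw ** transpose Bw) *v x) = (norm v)\<^sup>2"
      using norm_cmat_sq[of "transpose Bw" x] by (simp add: v_def)
    ultimately show ?thesis
      using inner_cmat_lyapunov[OF X, of x ?A] unfolding ric_def cmat_add[of _ "X ** ?S ** X"] cmat_add[of _ "t *\<^sub>R _"] p_def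
      by (simp only: matrix_vector_mult_add_rdistrib inner_add_right cmat_scaleR inner_scaleR_right cmat_add)
  qed
  moreover have "p \<bullet> ((\<i> * complex_of_real w) *s x) = 0"
    unfolding p_def inner_cmat_scale[OF X] by simp
  ultimately have uv: "?b * (norm u)\<^sup>2 = t * (norm v)\<^sup>2"
    unfolding eq Ax inner_diff_right pSp by simp
  have "u = 0"
  proof (rule ccontr)
    assume "u \<noteq> 0"
    then have "v \<noteq> 0" using uv \<open>beta > 0\<close> by auto
    have h: "0 \<le> ?h"
    proof -
      have "0 \<le> ?h * norm v"
        using Tinf_le_hinf_norm[OF weights lyap, of Bw w v] norm_ge_zero order_trans by blast
      then show ?thesis using \<open>v \<noteq> 0\<close> by (simp add: zero_le_mult_iff)
    qed
    have "?b * (norm u)\<^sup>2 \<le> 1 * (norm v)\<^sup>2" unfolding uv using t by (intro mult_right_mono) auto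
    also have "\<dots> \<le> (?b * (?h * norm u))\<^sup>2"
      unfolding mult_1 using v[OF \<open>v \<noteq> 0\<close>] by (rule power_mono) simp
    finally have "?b * (norm u)\<^sup>2 \<le> ?b * (norm u)\<^sup>2 * (?b * ?h\<^sup>2)" by (simp add: power2_eq_square algebra_simps)
    moreover have "?b * (norm u)\<^sup>2 > 0" using \<open>u \<noteq> 0\<close> \<open>beta > 0\<close> by simp
    ultimately have "1 \<le> ?b * ?h\<^sup>2"
      using mult_le_cancel_left_pos[of "?b * (norm u)\<^sup>2" 1 "?b * ?h\<^sup>2"] by (simp only: mult_1_right)
    then have "beta\<^sup>2 \<le> ?h\<^sup>2" using \<open>beta > 0\<close> by (simp add: field_simps)
    moreover have "?h\<^sup>2 < beta\<^sup>2" using h hinf by (intro power_strict_mono) auto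
    ultimately show False by simp
  qed
  \<comment> \<open>With u = 0 the correction X S has no effect on x, which becomes a left
    eigenvector of the Hurwitz matrix A_K on the imaginary axis.\<close>
  then have "cmat ?S *v p = 0" unfolding Sp by simp
  with Ax have "cmat (transpose ?A) *v x = (\<i> * complex_of_real w) *s x" by simp
  then obtain z where "z \<noteq> 0" "cmat ?A *v z = (\<i> * complex_of_real w) *s z"
    using eigenvalue_transpose[OF x(1), of "cmat (transpose ?A)"] by (metis cmat_transpose transpose_transpose)
  with hurwitz_noimag[OF stab] show False unfolding noimag_def by blast
qed

section \<open>The stabilizing solution X_K\<close>

lemma riccati_stab_sol_iff:
  "riccati_stab_sol A B Bw Qi Ri beta K X \<longleftrightarrow>
    sym_mat X \<and> ric (closed_loop A B K) (inverse (beta\<^sup>2) *\<^sub>R SK Qi Ri K) (Bw ** transpose Bw) X = 0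
    \<and> lyap (closed_loop A B K + X ** (inverse (beta\<^sup>2) *\<^sub>R SK Qi Ri K))"
  by (simp add: riccati_stab_sol_def ric_def hurwitz_iff_lyap matrix_algebra)

text \<open>\<open>XK\<close> is a definite description, so existence by continuation and uniqueness
  by mutual comparison together give it its meaning.\<close>

lemma riccati_stab_sol_XK:
  assumes weights: "pd Qi" "pd Ri" and "beta > 0" and K: "K \<in> Kbeta A B Bw Qi Ri beta"
  shows "riccati_stab_sol A B Bw Qi Ri beta K (XK A B Bw Qi Ri beta K)"
proof -
  let ?A = "closed_loop A B K" and ?S = "inverse (beta\<^sup>2) *\<^sub>R SK Qi Ri K" and ?W = "Bw ** transpose Bw"
  have stab: "hurwitz ?A" and hinf: "hinf_norm A B Bw Qi Ri K < beta"
    using K by (auto simp: Kbeta_def stabilizing_set_def)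
  have S: "pd ?S" using assms by (intro pd_scaleR pd_SK) auto
  have W: "sym_mat ?W" by (simp add: sym_mat_def matrix_transpose_mul)
  obtain X where "sym_mat X" "ric ?A ?S ?W X = 0" "lyap (?A + X ** ?S)"
    by (rule ric_exists[OF stab S W hinf_norm_imp_noimag[OF weights \<open>beta > 0\<close> stab hinf]])
  then have "riccati_stab_sol A B Bw Qi Ri beta K X" by (simp add: riccati_stab_sol_iff)
  moreover have "Y = X"
    if "riccati_stab_sol A B Bw Qi Ri beta K X" "riccati_stab_sol A B Bw Qi Ri beta K Y" for X Y
    using ric_unique[OF pd_imp_psd[OF S]] that unfolding riccati_stab_sol_iff by blast
  ultimately show ?thesis unfolding XK_def by (metis theI)
qed

text \<open>X_K solves a Lyapunov equation of the Hurwitz matrix A_K whose right-hand side is -(W +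
  X S X).\<close>

lemma pd_XK:
  assumes "pd Qi" "pd Ri" and "beta > 0" and K: "K \<in> Kbeta A B Bw Qi Ri beta"
    and W: "pd (Bw ** transpose Bw)"
  shows "pd (XK A B Bw Qi Ri beta K)"
proof -
  let ?A = "closed_loop A B K" and ?S = "inverse (beta\<^sup>2) *\<^sub>R SK Qi Ri K" and ?W = "Bw ** transpose Bw"
  let ?X = "XK A B Bw Qi Ri beta K"
  have X: "sym_mat ?X" "ric ?A ?S ?W ?X = 0"
    using riccati_stab_sol_XK[OF assms(1-4)] by (auto simp: riccati_stab_sol_iff)
  have lyap: "lyap ?A" using K by (simp add: Kbeta_def stabilizing_set_def hurwitz_imp_lyap)
  have "psd (?X ** ?S ** ?X)"
    using assms X by (intro psd_sandwich psd_scaleR pd_imp_psd[OF pd_SK]) auto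
  then have "pd (?W + ?X ** ?S ** ?X)" using W by (intro pd_add_psd)
  moreover have "?W + ?X ** ?S ** ?X = - (?A ** ?X + ?X ** transpose ?A) + ric ?A ?S ?W ?X"
    by (simp add: ric_def)
  ultimately have "pd (- (?A ** ?X + ?X ** transpose ?A))" using X(2) by simp
  with lyap X(1) show ?thesis by (rule lyap_pd)
qed

section \<open>The linear matrix inequality\<close>

definition blockvec :: "real^'n \<Rightarrow> real^'n \<Rightarrow> real^'m \<Rightarrow> real^(('n + 'n) + 'm)" where
  "blockvec a b c = (\<chi> i. case i of Inl (Inl k) \<Rightarrow> a $ k | Inl (Inr k) \<Rightarrow> b $ k | Inr k \<Rightarrow> c $ k)"

lemma blockvec_cases:
  obtains a b c where "z = blockvec a b c"
proof
  show "z = blockvec (\<chi> k. z $ Inl (Inl k)) (\<chi> k. z $ Inl (Inr k)) (\<chi> k. z $ Inr k)"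
    by (auto simp: blockvec_def vec_eq_iff split: sum.split)
qed

lemma inner_blockvec: "blockvec a b c \<bullet> blockvec a' b' c' = a \<bullet> a' + b \<bullet> b' + c \<bullet> c'"
  by (simp add: inner_vec_def sum_UNIV_Plus blockvec_def)

abbreviation lmi_block where
  "lmi_block A B Bw X Y \<equiv> A ** X + X ** transpose A + B ** Y + transpose Y ** transpose B + Bw ** transpose Bw"

lemma Fcvx_blockvec:
  "Fcvx A B Bw Qi Ri beta X Y *v blockvec a b c =
    blockvec (lmi_block A B Bw X Y *v a + (X ** msqrt Qi) *v b + (transpose Y ** msqrt Ri) *v c)
      ((msqrt Qi ** X) *v a - beta\<^sup>2 *\<^sub>R b) ((msqrt Ri ** Y) *v a - beta\<^sup>2 *\<^sub>R c)"
proof -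
  have *: "(\<Sum>k\<in>UNIV. (if i = k then - r else 0) * f k) = - r * f i" for i :: "'k::finite" and r :: real and f
    by (simp add: if_distrib[of "\<lambda>x. x * _"] cong: if_cong)
  show ?thesis
    unfolding vec_eq_iff
  proof
    fix i :: "('a + 'a) + 'b"
    have "(Fcvx A B Bw Qi Ri beta X Y *v blockvec a b c) $ i =
      (\<Sum>k\<in>UNIV. Fcvx A B Bw Qi Ri beta X Y $ i $ Inl (Inl k) * a $ k)
      + (\<Sum>k\<in>UNIV. Fcvx A B Bw Qi Ri beta X Y $ i $ Inl (Inr k) * b $ k)
      + (\<Sum>k\<in>UNIV. Fcvx A B Bw Qi Ri beta X Y $ i $ Inr k * c $ k)"
      by (simp add: matrix_vector_mult_def[of "Fcvx A B Bw Qi Ri beta X Y"] sum_UNIV_Plus blockvec_def)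
    then show "(Fcvx A B Bw Qi Ri beta X Y *v blockvec a b c) $ i =
      blockvec (lmi_block A B Bw X Y *v a + (X ** msqrt Qi) *v b + (transpose Y ** msqrt Ri) *v c)
      ((msqrt Qi ** X) *v a - beta\<^sup>2 *\<^sub>R b) ((msqrt Ri ** Y) *v a - beta\<^sup>2 *\<^sub>R c) $ i"
      by (cases i rule: sum.exhaust[case_product sum.exhaust])
         (auto simp: Fcvx_def Let_def blockvec_def * matrix_vector_mult_def[of _ a]
           matrix_vector_mult_def[of _ b] matrix_vector_mult_def[of _ c] split: sum.split)
  qed
qed

lemma sym_mat_Fcvx:
  assumes "sym_mat X" "sym_mat (msqrt Qi)" "sym_mat (msqrt Ri)"
  shows "sym_mat (Fcvx A B Bw Qi Ri beta X Y)"
proof -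
  have "transpose (lmi_block A B Bw X Y) = lmi_block A B Bw X Y"
    using assms by (simp add: transpose_algebra sym_matD algebra_simps)
  then have 1: "lmi_block A B Bw X Y $ i $ j = lmi_block A B Bw X Y $ j $ i" for i j
    by (metis (no_types) transpose_def vec_lambda_beta)
  have "transpose (X ** msqrt Qi) = msqrt Qi ** X"
    using assms by (simp add: transpose_algebra sym_matD)
  then have 2: "(msqrt Qi ** X) $ i $ j = (X ** msqrt Qi) $ j $ i" for i j
    by (metis (no_types) transpose_def vec_lambda_beta)
  have "transpose (transpose Y ** msqrt Ri) = msqrt Ri ** Y"
    using assms by (simp add: transpose_algebra sym_matD)
  then have 3: "(msqrt Ri ** Y) $ i $ j = (transpose Y ** msqrt Ri) $ j $ i" for i j
    by (metis (no_types) transpose_def vec_lambda_beta)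
  show ?thesis
    unfolding sym_mat_def vec_eq_iff transpose_def[of "Fcvx _ _ _ _ _ _ _ _"]
    using 1 2 3 by (auto simp: Fcvx_def Let_def split: sum.split)
qed

section \<open>The LMI and the cost in the variables X and Y = K X\<close>

locale mixed_design =
  fixes A :: "real^'n^'n" and B :: "real^'m^'n" and Bw Q2 Qi :: "real^'n^'n"
    and R2 Ri :: "real^'m^'m" and beta :: real
  assumes Q2: "psd Q2" and R2: "pd R2" and Qi: "pd Qi" and Ri: "pd Ri" and beta: "beta > 0"
    and W: "pd (Bw ** transpose Bw)"
begin

abbreviation "S K \<equiv> inverse (beta\<^sup>2) *\<^sub>R SK Qi Ri K"

text \<open>Up to the substitution Y = K X, the Schur complement of the two lower diagonal blocks in
  \<open>Fcvx\<close>.\<close>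

definition lmi :: "real^'n^'n \<Rightarrow> real^'n^'m \<Rightarrow> real^'n^'n" where
  "lmi X K = ric (closed_loop A B K) (S K) (Bw ** transpose Bw) X"

definition cost :: "real^'n^'n \<Rightarrow> real^'n^'m \<Rightarrow> real" where
  "cost X K = trace ((Q2 + transpose K ** R2 ** K) ** X)"

text \<open>The quadratic form of \<open>lmi X K\<close> at \<open>v\<close>, as a function of \<open>a = X *v v\<close> and
  \<open>b = (K ** X) *v v\<close>, in which it is convex.\<close>

definition lmi_form :: "real^'n \<Rightarrow> real^'n \<Rightarrow> real^'m \<Rightarrow> real" where
  "lmi_form v a b = 2 * (a \<bullet> (transpose A *v v)) + 2 * (b \<bullet> (transpose B *v v))
    + inverse (beta\<^sup>2) * (a \<bullet> (Qi *v a) + b \<bullet> (Ri *v b)) + v \<bullet> ((Bw ** transpose Bw) *v v)"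

lemma pd_S: "pd (S K)"
  using beta by (intro pd_scaleR pd_SK Qi Ri) auto

lemma sym_mat_lmi: "sym_mat X \<Longrightarrow> sym_mat (lmi X K)"
  unfolding lmi_def by (intro sym_mat_ric pd_sym[OF pd_S] pd_sym[OF W])

lemma inner_lmi:
  assumes "sym_mat X"
  shows "v \<bullet> (lmi X K *v v) = lmi_form v (X *v v) (K *v (X *v v))"
proof -
  have "(X *v v) \<bullet> (transpose (closed_loop A B K) *v v) =
    (X *v v) \<bullet> (transpose A *v v) + (K *v (X *v v)) \<bullet> (transpose B *v v)"
    by (simp add: closed_loop_def transpose_algebra matrix_vector_algebra inner_add_right
        inner_matrix_vector[of _ "transpose K"])
  then show ?thesis
    unfolding lmi_def inner_ric[OF assms] lmi_form_def
    by (simp add: scaleR_matrix_vector SK_inner)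
qed

text \<open>Only the terms in \<open>Qi\<close> and \<open>Ri\<close> are not affine in (a, b); for
  such a form the convexity defect is s (1 - s) times its value at the difference of the
  endpoints.\<close>

lemma lmi_form_convex:
  assumes "0 \<le> s" "s \<le> 1"
  shows "lmi_form v ((1 - s) *\<^sub>R a + s *\<^sub>R a') ((1 - s) *\<^sub>R b + s *\<^sub>R b')
    \<le> (1 - s) * lmi_form v a b + s * lmi_form v a' b'"
proof -
  have q: "((1 - s) *\<^sub>R x + s *\<^sub>R x') \<bullet> (M *v ((1 - s) *\<^sub>R x + s *\<^sub>R x'))
    \<le> (1 - s) * (x \<bullet> (M *v x)) + s * (x' \<bullet> (M *v x'))" if "psd M" for M :: "real^'k^'k" and x x'
  proof -
    have "x' \<bullet> (M *v x) = x \<bullet> (M *v x')"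
      using sym_mat_inner[OF psd_sym[OF that], of x' x] by (simp add: inner_commute)
    then have "(1 - s) * (x \<bullet> (M *v x)) + s * (x' \<bullet> (M *v x'))
        - ((1 - s) *\<^sub>R x + s *\<^sub>R x') \<bullet> (M *v ((1 - s) *\<^sub>R x + s *\<^sub>R x'))
      = (s * (1 - s)) * ((x - x') \<bullet> (M *v (x - x')))"
      by (simp add: matrix_vector_algebra inner_add_left inner_add_right inner_diff_left inner_diff_right)
         (simp add: algebra_simps)
    moreover have "0 \<le> (s * (1 - s)) * ((x - x') \<bullet> (M *v (x - x')))"
      using assms psdD[OF that] by simp
    ultimately show ?thesis by linarith
  qed
  let ?a = "(1 - s) *\<^sub>R a + s *\<^sub>R a'" and ?b = "(1 - s) *\<^sub>R b + s *\<^sub>R b'"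
  have "inverse (beta\<^sup>2) * (?a \<bullet> (Qi *v ?a) + ?b \<bullet> (Ri *v ?b)) \<le> inverse (beta\<^sup>2) *
    (((1 - s) * (a \<bullet> (Qi *v a)) + s * (a' \<bullet> (Qi *v a'))) + ((1 - s) * (b \<bullet> (Ri *v b)) + s * (b' \<bullet> (Ri *v b'))))"
    by (intro mult_left_mono add_mono q pd_imp_psd Qi Ri) simp
  then show ?thesis
    unfolding lmi_form_def inner_add_left inner_scaleR_left
    by (simp add: algebra_simps)
qed

text \<open>Schur complement by completing the square: the negated block form is the negated form of
  \<open>lmi X K\<close> plus two squares, in which the lower components are free.\<close>

lemma Fcvx_psd_iff:
  assumes X: "sym_mat X"
  shows "psd (- Fcvx A B Bw Qi Ri beta X (K ** X)) \<longleftrightarrow> psd (- lmi X K)"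
proof -
  let ?F = "Fcvx A B Bw Qi Ri beta X (K ** X)"
  let ?q = "msqrt Qi" and ?r = "msqrt Ri"
  have sym: "sym_mat ?F" by (rule sym_mat_Fcvx[OF X msqrt_pd(1)[OF Qi] msqrt_pd(1)[OF Ri]])
  have qq: "(?q *v x) \<bullet> (?q *v x) = x \<bullet> (Qi *v x)" for x
    using sym_mat_inner[OF msqrt_pd(1)[OF Qi], of x "?q *v x"] msqrt_pd(2)[OF Qi]
    by (simp add: matrix_vector_mul_assoc)
  have rr: "(?r *v x) \<bullet> (?r *v x) = x \<bullet> (Ri *v x)" for x
    using sym_mat_inner[OF msqrt_pd(1)[OF Ri], of x "?r *v x"] msqrt_pd(2)[OF Ri]
    by (simp add: matrix_vector_mul_assoc)
  have form: "- (blockvec a b c \<bullet> (?F *v blockvec a b c)) =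
    - (a \<bullet> (lmi X K *v a)) + (norm (beta *\<^sub>R b - inverse beta *\<^sub>R (?q *v (X *v a))))\<^sup>2
      + (norm (beta *\<^sub>R c - inverse beta *\<^sub>R (?r *v (K *v (X *v a)))))\<^sup>2" for a b c
  proof -
    have M: "a \<bullet> (lmi_block A B Bw X (K ** X) *v a) =
      2 * ((X *v a) \<bullet> (transpose A *v a)) + 2 * ((K *v (X *v a)) \<bullet> (transpose B *v a))
      + a \<bullet> ((Bw ** transpose Bw) *v a)"
      using sym_mat_inner[OF X, of a]
      by (simp add: transpose_algebra sym_matD[OF X] matrix_vector_algebra inner_add_right
          inner_matrix_vector[of _ A] inner_matrix_vector[of _ B] inner_matrix_vector[of _ "transpose K"] inner_commute)
    have b: "a \<bullet> ((X ** ?q) *v b) = (?q *v (X *v a)) \<bullet> b"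
      by (simp add: matrix_vector_algebra sym_mat_inner[OF X] sym_mat_inner[OF msqrt_pd(1)[OF Qi]])
    have c: "a \<bullet> ((transpose (K ** X) ** ?r) *v c) = (?r *v (K *v (X *v a))) \<bullet> c"
      by (simp add: matrix_vector_algebra transpose_algebra sym_matD[OF X] sym_mat_inner[OF X]
          inner_matrix_vector[of _ "transpose K"] sym_mat_inner[OF msqrt_pd(1)[OF Ri]])
    have sq: "(norm (beta *\<^sub>R u - inverse beta *\<^sub>R w))\<^sup>2 =
      beta\<^sup>2 * (u \<bullet> u) - 2 * (w \<bullet> u) + inverse (beta\<^sup>2) * (w \<bullet> w)" for u w :: "real^'k"
      using beta unfolding power2_norm_eq_inner
      by (simp add: inner_diff_left inner_diff_right inner_commute power2_eq_square)
    show ?thesis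
      unfolding Fcvx_blockvec inner_blockvec inner_lmi[OF X] lmi_form_def sq qq rr inner_add_right inner_diff_right M b c
      by (simp add: matrix_vector_mul_assoc[symmetric] algebra_simps inner_commute)
  qed
  show ?thesis
  proof
    assume F: "psd (- ?F)"
    have "0 \<le> a \<bullet> ((- lmi X K) *v a)" for a
    proof -
      \<comment> \<open>These lower components make both squares vanish.\<close>
      let ?b = "inverse (beta\<^sup>2) *\<^sub>R (?q *v (X *v a))" and ?c = "inverse (beta\<^sup>2) *\<^sub>R (?r *v (K *v (X *v a)))"
      have "beta * inverse (beta\<^sup>2) = inverse beta" using beta by (simp add: power2_eq_square)
      then have "- (blockvec a ?b ?c \<bullet> (?F *v blockvec a ?b ?c)) = - (a \<bullet> (lmi X K *v a))"
        unfolding form by simp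
      then show ?thesis using psdD[OF F, of "blockvec a ?b ?c"] by (simp add: matrix_vector_mul_uminus)
    qed
    then show "psd (- lmi X K)" using X by (simp add: psd_def sym_mat_minus sym_mat_lmi)
  next
    assume L: "psd (- lmi X K)"
    have "0 \<le> z \<bullet> ((- ?F) *v z)" for z
    proof -
      obtain a b c where z: "z = blockvec a b c" by (rule blockvec_cases)
      have "0 \<le> - (a \<bullet> (lmi X K *v a))" using psdD[OF L, of a] by (simp add: matrix_vector_mul_uminus)
      then have "0 \<le> - (z \<bullet> (?F *v z))" unfolding z form by (intro add_nonneg_nonneg) auto
      then show ?thesis by (simp add: matrix_vector_mul_uminus)
    qed
    then show "psd (- ?F)" using sym by (simp add: psd_def sym_mat_minus)
  qed
qed

lemma cost_eq: "cost X K = trace (Q2 ** X) + trace (R2 ** (K ** X ** transpose K))"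
proof -
  have "trace (transpose K ** R2 ** K ** X) = trace (R2 ** (K ** X ** transpose K))"
    by (metis matrix_mul_assoc trace_mul_sym)
  then show ?thesis by (simp add: cost_def matrix_add_rdistrib trace_add)
qed

text \<open>Y and K = Y X^-1 determine each other for positive definite X; in terms of K the inverse
  in the cost cancels.\<close>

lemma Fcvx_set_iff:
  "(g, X, Y) \<in> Fcvx_set A B Bw Q2 R2 Qi Ri beta \<longleftrightarrow>
    (\<exists>K. Y = K ** X \<and> pd X \<and> psd (- lmi X K) \<and> cost X K \<le> g)"
proof -
  have c: "trace (Q2 ** X) + trace (R2 ** (K ** X) ** matrix_inv X ** transpose (K ** X)) = cost X K"
    if "pd X" for K
  proof -
    have "R2 ** (K ** X) ** matrix_inv X ** transpose (K ** X) = R2 ** K ** (X ** matrix_inv X) ** X ** transpose K"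
      by (simp add: matrix_transpose_mul sym_matD[OF pd_sym[OF that]] matrix_mul_assoc)
    also have "\<dots> = R2 ** (K ** X ** transpose K)"
      by (simp add: matrix_inv_mul[OF pd_invertible[OF that]]) (simp add: matrix_mul_assoc)
    finally show ?thesis by (simp add: cost_eq)
  qed
  have "\<exists>K. Y = K ** X" if "pd X"
  proof
    show "Y = (Y ** matrix_inv X) ** X"
      by (simp add: matrix_mul_assoc[symmetric] matrix_inv_mul[OF pd_invertible[OF that]])
  qed
  then show ?thesis
    unfolding Fcvx_set_def mem_Collect_eq prod.case using c Fcvx_psd_iff pd_sym by metis
qed

lemma cost_nonneg: "psd X \<Longrightarrow> 0 \<le> cost X K"
  unfolding cost_def
  by (intro trace_psd_mul_nonneg psd_add Q2)
     (use psd_congruence[OF pd_imp_psd[OF R2], of "transpose K"] in simp_all)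

lemma cost_mono:
  assumes "psd (Y - X)"
  shows "cost X K \<le> cost Y K"
proof -
  have "0 \<le> cost (Y - X) K" by (rule cost_nonneg[OF assms])
  also have "\<dots> = cost Y K - cost X K" by (simp add: cost_def matrix_mul_diff_right trace_sub)
  finally show ?thesis by simp
qed

lemma XK_feasible:
  assumes "K \<in> Kbeta A B Bw Qi Ri beta"
  defines "X \<equiv> XK A B Bw Qi Ri beta K"
  shows "pd X" "lmi X K = 0" "Jmix A B Bw Q2 R2 Qi Ri beta K = cost X K"
  using pd_XK[OF Qi Ri beta assms(1) W] riccati_stab_sol_XK[OF Qi Ri beta assms(1)]
  by (simp_all add: X_def riccati_stab_sol_iff lmi_def Jmix_def cost_def)

lemma strictly_feasible_imp_Kbeta:
  assumes "pd X" "pd (- lmi X K)"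
  shows "K \<in> Kbeta A B Bw Qi Ri beta" "Jmix A B Bw Q2 R2 Qi Ri beta K \<le> cost X K"
proof -
  show K: "K \<in> Kbeta A B Bw Qi Ri beta"
    using strict_riccati_imp_Kbeta[OF Qi Ri beta assms(1)] assms(2) by (simp add: lmi_def)
  let ?X = "XK A B Bw Qi Ri beta K"
  have "psd (X - ?X)"
    using riccati_stab_sol_XK[OF Qi Ri beta K] assms
    unfolding riccati_stab_sol_iff lmi_def
    by (intro ric_comparison[OF pd_imp_psd[OF pd_S]]) (auto intro: pd_sym pd_imp_psd)
  then show "Jmix A B Bw Q2 R2 Qi Ri beta K \<le> cost X K"
    unfolding XK_feasible(3)[OF K] by (rule cost_mono)
qed

text \<open>Moving from X_K by e D, where D solves the Lyapunov equation of the linearisation with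
  right-hand side -I, changes the residual to -e I + e^2 D S D. This is negative definite for small
  e.\<close>

lemma strictly_feasible_exists:
  assumes "K \<in> Kbeta A B Bw Qi Ri beta"
  obtains X where "pd X" "pd (- lmi X K)"
proof -
  let ?X = "XK A B Bw Qi Ri beta K" and ?A = "closed_loop A B K"
  let ?M = "?A + ?X ** S K"
  have X: "pd ?X" "lmi ?X K = 0" using XK_feasible[OF assms] by auto
  have "lyap ?M" using riccati_stab_sol_XK[OF Qi Ri beta assms] by (simp add: riccati_stab_sol_iff)
  then obtain D where D: "pd D" "?M ** D + D ** transpose ?M = - mat 1" by (rule lyap_normalized, blast)
  have "sym_mat (D ** S K ** D)" by (intro sym_mat_sandwich pd_sym[OF pd_S] pd_sym[OF D(1)])
  then obtain e where e: "e > 0" "pd (mat 1 - e *\<^sub>R (D ** S K ** D))"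
    by (rule pd_minus_small[OF pd_mat1], blast)
  have "?M ** (e *\<^sub>R D) + (e *\<^sub>R D) ** transpose ?M = e *\<^sub>R (- mat 1)"
    unfolding D(2)[symmetric] by (simp only: scaleR_matrix_mul_left scaleR_matrix_mul_right scaleR_add_right)
  then have "lmi (?X + e *\<^sub>R D) K = e *\<^sub>R (- mat 1) + (e *\<^sub>R D) ** S K ** (e *\<^sub>R D)"
    unfolding lmi_def ric_add[OF pd_sym[OF pd_S] pd_sym[OF X(1)], of _ _ _ _ "Bw ** transpose Bw"]
    using X(2) by (simp add: lmi_def)
  also have "\<dots> = - (e *\<^sub>R (mat 1 - e *\<^sub>R (D ** S K ** D)))"
    by (simp only: scaleR_matrix_mul_left scaleR_matrix_mul_right scaleR_diff_right) simp
  finally have "pd (- lmi (?X + e *\<^sub>R D) K)" using pd_scaleR[OF e] by simp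
  moreover have "pd (?X + e *\<^sub>R D)" using X(1) D(1) e(1) by (intro pd_add_psd pd_imp_psd[OF pd_scaleR])
  ultimately show ?thesis using that by blast
qed

text \<open>X and Y = K X are averaged, not the gains, and the new gain is recovered as Y X'^-1.
  Convexity of the form gives the LMI, strict because the strictly feasible pair enters with weight
  s > 0.\<close>

lemma feasible_convex_combination:
  assumes X: "pd X" "psd (- lmi X K)" and Z: "pd Z" "pd (- lmi Z L)" and s: "0 < s" "s \<le> 1"
  obtains X' K' where "pd X'" "pd (- lmi X' K')" "cost X' K' \<le> (1 - s) * cost X K + s * cost Z L"
proof -
  define X' where "X' = (1 - s) *\<^sub>R X + s *\<^sub>R Z"
  define Y where "Y = (1 - s) *\<^sub>R (K ** X) + s *\<^sub>R (L ** Z)"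
  define K' where "K' = Y ** matrix_inv X'"
  have X': "pd X'"
    unfolding X'_def using s
    by (subst add.commute) (intro pd_add_psd pd_scaleR psd_scaleR Z X pd_imp_psd[OF X(1)]; simp)
  have Y: "K' ** X' = Y"
    by (simp add: K'_def matrix_mul_assoc[symmetric] matrix_inv_mul[OF pd_invertible[OF X']])
  have "0 < v \<bullet> ((- lmi X' K') *v v)" if "v \<noteq> 0" for v
  proof -
    have "K' *v (X' *v v) = (1 - s) *\<^sub>R (K *v (X *v v)) + s *\<^sub>R (L *v (Z *v v))"
      by (simp add: matrix_vector_mul_assoc Y) (simp add: Y_def matrix_vector_mult_add_rdistrib scaleR_matrix_vector)
    then have "v \<bullet> (lmi X' K' *v v) \<le> (1 - s) * (v \<bullet> (lmi X K *v v)) + s * (v \<bullet> (lmi Z L *v v))"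
      unfolding inner_lmi[OF pd_sym[OF X']] inner_lmi[OF pd_sym[OF X(1)]] inner_lmi[OF pd_sym[OF Z(1)]]
      using lmi_form_convex[of s v "X *v v" "Z *v v"] s
      by (simp add: X'_def matrix_vector_mult_add_rdistrib scaleR_matrix_vector)
    moreover have "(1 - s) * (v \<bullet> (lmi X K *v v)) \<le> 0"
      using psdD[OF X(2), of v] s by (simp add: matrix_vector_mul_uminus mult_nonneg_nonpos)
    moreover have "s * (v \<bullet> (lmi Z L *v v)) < 0"
      using pdD[OF Z(2) that] s by (simp add: matrix_vector_mul_uminus mult_pos_neg)
    ultimately show ?thesis by (simp add: matrix_vector_mul_uminus)
  qed
  then have lmi: "pd (- lmi X' K')" using pd_sym[OF X'] by (simp add: pd_def sym_mat_minus sym_mat_lmi)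
  \<comment> \<open>A matrix variance: K' is the mean of K and L with weights (1 - s) X and s Z.
    Hence V is also the gap between averaged and new K X K^T, and its trace against
    \<open>R2\<close> is the convexity gap of the cost.\<close>
  define V where "V = (1 - s) *\<^sub>R ((K - K') ** X ** transpose (K - K')) + s *\<^sub>R ((L - K') ** Z ** transpose (L - K'))"
  have "psd V" unfolding V_def using s X(1) Z(1) by (intro psd_add psd_scaleR psd_congruence pd_imp_psd) auto
  have YT: "transpose Y = X' ** transpose K'"
    unfolding Y[symmetric] by (simp add: matrix_transpose_mul sym_matD[OF pd_sym[OF X']])
  have "V = (1 - s) *\<^sub>R (K ** X ** transpose K) + s *\<^sub>R (L ** Z ** transpose L)
      - Y ** transpose K' - K' ** transpose Y + K' ** X' ** transpose K'"
    unfolding V_def Y_def X'_def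
    by (simp add: transpose_algebra sym_matD[OF pd_sym[OF X(1)]] sym_matD[OF pd_sym[OF Z(1)]] matrix_algebra
        scaleR_diff_right scaleR_add_right)
  also have "\<dots> = (1 - s) *\<^sub>R (K ** X ** transpose K) + s *\<^sub>R (L ** Z ** transpose L) - K' ** X' ** transpose K'"
    unfolding YT unfolding Y[symmetric] by (simp add: matrix_mul_assoc)
  finally have V: "V = \<dots>" .
  have tQ: "trace (Q2 ** X') = (1 - s) * trace (Q2 ** X) + s * trace (Q2 ** Z)"
    by (simp only: X'_def matrix_add_ldistrib scaleR_matrix_mul_right trace_add trace_scaleR)
  have "0 \<le> trace (R2 ** V)" by (rule trace_psd_mul_nonneg[OF pd_imp_psd[OF R2] \<open>psd V\<close>])
  also have "\<dots> = (1 - s) * cost X K + s * cost Z L - cost X' K'"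
    unfolding V cost_eq tQ
    by (simp add: matrix_mul_diff_right matrix_add_ldistrib scaleR_matrix_mul_right trace_sub trace_add
        trace_scaleR algebra_simps)
  finally show ?thesis using that X' lmi by simp
qed

end

section \<open>Existence of the minimum\<close>

lemma closed_psd: "closed {X :: real^'n^'n. psd X}"
  unfolding closed_sequential_limits using psd_limit by blast

lemma trace_congruence: "trace (K ** X ** transpose K) = (\<Sum>i\<in>UNIV. K $ i \<bullet> (X *v K $ i))"
  for X :: "real^'n^'n" and K :: "real^'n^'m"
  unfolding trace_def
proof (rule sum.cong[OF refl])
  fix i
  have "transpose K *v axis i 1 = K $ i"
    by (simp add: matrix_vector_mult_basis row_def)
  moreover have "(K ** X ** transpose K) $ i $ i = axis i 1 \<bullet> ((K ** X ** transpose K) *v axis i 1)"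
    by (simp add: inner_axis' matrix_vector_mul_component inner_axis)
  ultimately show "(K ** X ** transpose K) $ i $ i = K $ i \<bullet> (X *v K $ i)"
    by (simp only: matrix_vector_mul_assoc[symmetric] inner_matrix_vector[of _ K])
qed

text \<open>Cauchy-Schwarz in the form of \<open>X\<close>, row by row of K. It controls Y v by the
  control cost and the form of X at v.\<close>

lemma norm_matrix_vector_sq_le:
  fixes X :: "real^'n^'n" and K :: "real^'n^'m"
  assumes "psd X"
  shows "(norm (K *v (X *v v)))\<^sup>2 \<le> trace (K ** X ** transpose K) * (v \<bullet> (X *v v))"
proof -
  have "(norm (K *v (X *v v)))\<^sup>2 = (\<Sum>i\<in>UNIV. (K $ i \<bullet> (X *v v))\<^sup>2)"
    unfolding power2_norm_eq_inner inner_vec_def[of "K *v _"]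
    by (simp add: matrix_vector_mul_component power2_eq_square)
  also have "\<dots> \<le> (\<Sum>i\<in>UNIV. (K $ i \<bullet> (X *v K $ i)) * (v \<bullet> (X *v v)))"
    by (intro sum_mono psd_cauchy_schwarz assms)
  finally show ?thesis by (simp add: trace_congruence sum_distrib_right)
qed

context mixed_design
begin

text \<open>With N the norm of (X v, K X v), the LMI yields m N^2 + w |v|^2 <= p N |v|. Dropping the
  w term bounds X above; dropping the m term bounds N below, and N^2 <= (c + t) (v . X v) turns this
  into X >= e I. The trace bound on K X K^T then bounds K.\<close>

lemma feasible_bounds:
  obtains C e where "e > 0"
    "\<And>X K. pd X \<Longrightarrow> psd (- lmi X K) \<Longrightarrow> cost X K \<le> g \<Longrightarrow>
      norm X \<le> C \<and> norm K \<le> C \<and> psd (X - e *\<^sub>R mat 1)"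
proof -
  obtain q where q: "q > 0" "\<And>x. q * (x \<bullet> x) \<le> x \<bullet> (Qi *v x)" by (rule pd_elliptic[OF Qi], blast)
  obtain r where r: "r > 0" "\<And>x. r * (x \<bullet> x) \<le> x \<bullet> (Ri *v x)" by (rule pd_elliptic[OF Ri], blast)
  obtain r2 where r2: "r2 > 0" "\<And>x. r2 * (x \<bullet> x) \<le> x \<bullet> (R2 *v x)" by (rule pd_elliptic[OF R2], blast)
  obtain w where w: "w > 0" "\<And>x. w * (x \<bullet> x) \<le> x \<bullet> ((Bw ** transpose Bw) *v x)" by (rule pd_elliptic[OF W], blast)
  obtain a where a: "a > 0" "\<And>x. norm (transpose A *v x) \<le> a * norm x" by (rule matrix_vector_bound, blast)
  obtain b where b: "b > 0" "\<And>x. norm (transpose B *v x) \<le> b * norm x" by (rule matrix_vector_bound, blast)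
  define m where "m = inverse (beta\<^sup>2) * min q r"
  define p where "p = 2 * (a + b)"
  \<comment> \<open>The constant of \<open>quadratic_bound\<close>; the 0 stands for its absent pure
    |v|^2 term.\<close>
  define c where "c = 1 + (p + 0) / m"
  \<comment> \<open>Bounds the trace of K X K^T, as \<open>R2\<close> is at least r2 I and the cost
    at most g.\<close>
  define t where "t = \<bar>g\<bar> / r2"
  define e where "e = w\<^sup>2 / (p\<^sup>2 * (c + t))"
  define n where "n = real CARD('n)"
  have m: "m > 0" using q r beta by (simp add: m_def)
  have p: "p > 0" using a b by (simp add: p_def)
  have c: "c > 0" using p m by (simp add: c_def add_pos_pos)
  have t: "t \<ge> 0" using r2 by (simp add: t_def)
  have e: "e > 0" using w p c t by (simp add: e_def)
  have "norm X \<le> max (n * (n * c)) (sqrt (t / e)) \<and> norm K \<le> max (n * (n * c)) (sqrt (t / e))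
      \<and> psd (X - e *\<^sub>R mat 1)"
    if X: "pd X" and L: "psd (- lmi X K)" and cost: "cost X K \<le> g" for X K
  proof -
    have psd: "psd X" by (rule pd_imp_psd[OF X])
    let ?N = "\<lambda>v. norm (X *v v, K *v (X *v v))"
    have N: "(?N v)\<^sup>2 = (norm (X *v v))\<^sup>2 + (norm (K *v (X *v v)))\<^sup>2" for v by (simp add: norm_Pair)
    have main: "m * (?N v)\<^sup>2 + w * (norm v)\<^sup>2 \<le> p * ?N v * norm v" for v
    proof -
      let ?x = "X *v v" and ?y = "K *v (X *v v)"
      have "0 \<ge> lmi_form v ?x ?y"
        using psdD[OF L, of v] by (simp add: matrix_vector_mul_uminus inner_lmi[OF pd_sym[OF X]])
      moreover have "m * (?N v)\<^sup>2 \<le> inverse (beta\<^sup>2) * (?x \<bullet> (Qi *v ?x) + ?y \<bullet> (Ri *v ?y))"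
      proof -
        have "min q r * (norm ?x)\<^sup>2 \<le> ?x \<bullet> (Qi *v ?x)"
          by (rule order_trans[OF _ q(2)]) (auto simp: dot_square_norm intro: mult_right_mono)
        moreover have "min q r * (norm ?y)\<^sup>2 \<le> ?y \<bullet> (Ri *v ?y)"
          by (rule order_trans[OF _ r(2)]) (auto simp: dot_square_norm intro: mult_right_mono)
        ultimately have "min q r * (?N v)\<^sup>2 \<le> ?x \<bullet> (Qi *v ?x) + ?y \<bullet> (Ri *v ?y)"
          unfolding N distrib_left by linarith
        then show ?thesis unfolding m_def mult.assoc by (rule mult_left_mono) simp
      qed
      moreover have "w * (norm v)\<^sup>2 \<le> v \<bullet> ((Bw ** transpose Bw) *v v)"
        using w(2)[of v] by (simp add: dot_square_norm)
      moreover have "- (?x \<bullet> (transpose A *v v)) \<le> ?N v * (a * norm v)"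
      proof -
        have "- (?x \<bullet> (transpose A *v v)) \<le> norm ?x * norm (transpose A *v v)"
          using Cauchy_Schwarz_ineq2[of ?x "transpose A *v v"] by linarith
        also have "\<dots> \<le> ?N v * (a * norm v)" by (intro mult_mono a(2) norm_fst_le) auto
        finally show ?thesis .
      qed
      moreover have "- (?y \<bullet> (transpose B *v v)) \<le> ?N v * (b * norm v)"
      proof -
        have "- (?y \<bullet> (transpose B *v v)) \<le> norm ?y * norm (transpose B *v v)"
          using Cauchy_Schwarz_ineq2[of ?y "transpose B *v v"] by linarith
        also have "\<dots> \<le> ?N v * (b * norm v)" by (intro mult_mono b(2) norm_snd_le) auto
        finally show ?thesis .
      qed
      moreover have "p * ?N v * norm v = 2 * (?N v * (a * norm v)) + 2 * (?N v * (b * norm v))"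
        by (simp add: p_def algebra_simps)
      ultimately show ?thesis unfolding lmi_form_def by linarith
    qed
    have Nle: "?N v \<le> c * norm v" for v
      unfolding c_def
    proof (rule quadratic_bound)
      show "m * (?N v)\<^sup>2 \<le> p * ?N v * norm v + 0 * (norm v)\<^sup>2"
        using main[of v] w(1) by (smt (verit) mult_nonneg_nonneg zero_le_power2 mult_zero_left)
    qed (use m p in auto)
    have Xle: "norm (X *v v) \<le> c * norm v" for v using Nle norm_fst_le order_trans by blast
    have tr: "trace (K ** X ** transpose K) \<le> t"
    proof -
      have "psd (R2 - r2 *\<^sub>R mat 1)"
        using r2(2) pd_sym[OF R2]
        by (simp add: psd_def sym_mat_intros matrix_vector_algebra inner_diff_right)
      then have "0 \<le> trace ((R2 - r2 *\<^sub>R mat 1) ** (K ** X ** transpose K))"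
        by (rule trace_psd_mul_nonneg[OF _ psd_congruence[OF psd]])
      also have "\<dots> = trace (R2 ** (K ** X ** transpose K)) - r2 * trace (K ** X ** transpose K)"
        by (simp only: matrix_mul_diff_left scaleR_matrix_mul_left matrix_mul_lid trace_sub trace_scaleR)
      finally have "r2 * trace (K ** X ** transpose K) \<le> trace (R2 ** (K ** X ** transpose K))" by simp
      also have "\<dots> \<le> cost X K" unfolding cost_eq using trace_psd_mul_nonneg[OF Q2 psd] by simp
      also have "\<dots> \<le> \<bar>g\<bar>" using cost by simp
      finally show ?thesis using r2(1) by (simp add: t_def field_simps)
    qed
    have lower: "e * (v \<bullet> v) \<le> v \<bullet> (X *v v)" for v
    proof (cases "v = 0")
      case False
      have vX: "0 \<le> v \<bullet> (X *v v)" by (rule psdD[OF psd])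
      \<comment> \<open>Cauchy-Schwarz in the form of \<open>X\<close> between X v and v, with the
        upper bound c on X applied to X v.\<close>
      have "(norm (X *v v))\<^sup>2 \<le> c * (v \<bullet> (X *v v))"
      proof (cases "X *v v = 0")
        case False
        let ?x = "X *v v"
        have "(?x \<bullet> (X *v v))\<^sup>2 \<le> (?x \<bullet> (X *v ?x)) * (v \<bullet> (X *v v))" by (rule psd_cauchy_schwarz[OF psd])
        also have "\<dots> \<le> (norm ?x * (c * norm ?x)) * (v \<bullet> (X *v v))"
          using norm_cauchy_schwarz[of ?x "X *v ?x"] mult_left_mono[OF Xle[of ?x] norm_ge_zero[of ?x]] vX
          by (intro mult_right_mono) linarith+
        finally have "(norm ?x)\<^sup>2 * (norm ?x)\<^sup>2 \<le> (norm ?x)\<^sup>2 * (c * (v \<bullet> ?x))"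
          by (simp add: dot_square_norm power2_eq_square algebra_simps)
        then show ?thesis by (rule mult_left_le_imp_le) (use False in simp)
      qed (use c vX in simp)
      moreover have "(norm (K *v (X *v v)))\<^sup>2 \<le> t * (v \<bullet> (X *v v))"
        using norm_matrix_vector_sq_le[OF psd, of K v] mult_right_mono[OF tr vX] by linarith
      ultimately have NX: "(?N v)\<^sup>2 \<le> (c + t) * (v \<bullet> (X *v v))" unfolding N by (simp add: algebra_simps)
      have "w * (norm v)\<^sup>2 \<le> p * ?N v * norm v"
        using main[of v] m by (smt (verit) mult_nonneg_nonneg zero_le_power2)
      then have "(w * norm v) * norm v \<le> (p * ?N v) * norm v" by (simp add: power2_eq_square algebra_simps)
      then have "w * norm v \<le> p * ?N v" using False by simp
      then have "(w * norm v)\<^sup>2 \<le> (p * ?N v)\<^sup>2" by (rule power_mono) (use w in simp)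
      also have "\<dots> \<le> p\<^sup>2 * ((c + t) * (v \<bullet> (X *v v)))"
        unfolding power_mult_distrib by (intro mult_left_mono NX) simp
      finally have "w\<^sup>2 * (v \<bullet> v) \<le> (p\<^sup>2 * (c + t)) * (v \<bullet> (X *v v))"
        by (simp add: power_mult_distrib dot_square_norm algebra_simps)
      moreover have "p\<^sup>2 * (c + t) > 0" using p c t by simp
      ultimately show ?thesis by (simp add: e_def divide_le_eq mult.commute)
    qed simp
    have "e * (norm K)\<^sup>2 = (\<Sum>i\<in>UNIV. e * (K $ i \<bullet> K $ i))"
      by (simp add: power2_norm_eq_inner inner_vec_def[of K] sum_distrib_left)
    also have "\<dots> \<le> trace (K ** X ** transpose K)"
      unfolding trace_congruence by (intro sum_mono lower)
    also have "\<dots> \<le> t" by (rule tr)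
    finally have "(norm K)\<^sup>2 \<le> t / e" using e by (simp add: field_simps)
    then have "norm K \<le> sqrt (t / e)" by (rule real_le_rsqrt)
    moreover have "norm X \<le> n * (n * c)" unfolding n_def by (rule norm_matrix_le[OF Xle])
    moreover have "psd (X - e *\<^sub>R mat 1)"
      using lower pd_sym[OF X] by (simp add: psd_def sym_mat_intros matrix_vector_algebra inner_diff_right)
    ultimately show ?thesis by auto
  qed
  with e that show ?thesis by blast
qed

text \<open>The sublevel set becomes compact once the open condition \<open>pd X\<close> is replaced
  by the closed X >= e I, which \<open>feasible_bounds\<close> grants. In (X, K) the constraint and
  the cost are continuous without any inverse.\<close>

lemma cost_attains_min:
  assumes "pd X0" "psd (- lmi X0 K0)"
  obtains X K where "pd X" "psd (- lmi X K)"
    "\<And>Z L. pd Z \<Longrightarrow> psd (- lmi Z L) \<Longrightarrow> cost X K \<le> cost Z L"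
proof -
  let ?g = "cost X0 K0"
  obtain C e where e: "e > 0" and bounds: "\<And>X K. pd X \<Longrightarrow> psd (- lmi X K) \<Longrightarrow> cost X K \<le> ?g \<Longrightarrow>
      norm X \<le> C \<and> norm K \<le> C \<and> psd (X - e *\<^sub>R mat 1)"
    by (rule feasible_bounds[of ?g], blast)
  define D where "D = (cball 0 C \<times> cball 0 C) \<inter> ((\<lambda>z. fst z - e *\<^sub>R mat 1) -` {M. psd M}
    \<inter> (\<lambda>z. - lmi (fst z) (snd z)) -` {M. psd M} \<inter> {z. cost (fst z) (snd z) \<le> ?g})"
  have cont: "continuous_on UNIV (\<lambda>z. - lmi (fst z) (snd z))" "continuous_on S (\<lambda>z. cost (fst z) (snd z))" for S
    unfolding lmi_def ric_def closed_loop_def SK_def cost_def trace_def by (intro continuous_intros)+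
  have "closed ((\<lambda>z :: (real^'n^'n) \<times> (real^'n^'m). fst z - e *\<^sub>R mat 1) -` {M. psd M})"
    by (rule closed_vimage[OF closed_psd]) (intro continuous_intros)
  moreover have "closed ((\<lambda>z. - lmi (fst z) (snd z)) -` {M. psd M})"
    by (rule closed_vimage[OF closed_psd cont(1)])
  moreover have "closed {z. cost (fst z) (snd z) \<le> ?g}"
    by (rule closed_Collect_le[OF cont(2) continuous_on_const])
  moreover have "compact (cball (0 :: real^'n^'n) C \<times> cball (0 :: real^'n^'m) C)"
    by (rule compact_Times[OF compact_cball compact_cball])
  ultimately have compact: "compact D" unfolding D_def by (intro compact_Int_closed closed_Int)
  have "(X0, K0) \<in> D" using bounds[OF assms] assms(2) by (simp add: D_def)
  then have "D \<noteq> {}" by blast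
  from continuous_attains_inf[OF compact this cont(2)]
  obtain z where z: "z \<in> D" "\<And>y. y \<in> D \<Longrightarrow> cost (fst z) (snd z) \<le> cost (fst y) (snd y)"
    by blast
  have "psd (fst z - e *\<^sub>R mat 1)" "psd (- lmi (fst z) (snd z))" "cost (fst z) (snd z) \<le> ?g"
    using z(1) by (auto simp: D_def)
  moreover from this(1) have "pd (fst z)"
    using pd_add_psd[OF pd_mat[OF e], of "fst z - e *\<^sub>R mat 1"] by simp
  moreover have "cost (fst z) (snd z) \<le> cost Z L" if "pd Z" "psd (- lmi Z L)" for Z L
  proof (cases "cost Z L \<le> ?g")
    case True
    then have "(Z, L) \<in> D" using bounds[OF that True] that(2) by (simp add: D_def)
    with z(2)[of "(Z, L)"] show ?thesis by simp
  next
    case False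
    with \<open>cost (fst z) (snd z) \<le> ?g\<close> show ?thesis by linarith
  qed
  ultimately show ?thesis using that by blast
qed

lemma INF_Jmix_le_cost:
  assumes K0: "K0 \<in> Kbeta A B Bw Qi Ri beta" and X: "pd X" "psd (- lmi X K)"
    and bdd: "bdd_below (Jmix A B Bw Q2 R2 Qi Ri beta ` Kbeta A B Bw Qi Ri beta)"
  shows "(INF K\<in>Kbeta A B Bw Qi Ri beta. Jmix A B Bw Q2 R2 Qi Ri beta K) \<le> cost X K"
proof -
  let ?J = "INF K\<in>Kbeta A B Bw Qi Ri beta. Jmix A B Bw Q2 R2 Qi Ri beta K"
  obtain Z where Z: "pd Z" "pd (- lmi Z K0)" by (rule strictly_feasible_exists[OF K0])
  have le: "?J \<le> (1 - s) * cost X K + s * cost Z K0" if s: "0 < s" "s \<le> 1" for s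
  proof -
    obtain X' K' where X': "pd X'" "pd (- lmi X' K')" "cost X' K' \<le> (1 - s) * cost X K + s * cost Z K0"
      by (rule feasible_convex_combination[OF X Z s])
    have "?J \<le> Jmix A B Bw Q2 R2 Qi Ri beta K'"
      by (rule cINF_lower[OF bdd strictly_feasible_imp_Kbeta(1)[OF X'(1,2)]])
    with strictly_feasible_imp_Kbeta(2)[OF X'(1,2)] X'(3) show ?thesis by linarith
  qed
  \<comment> \<open>The weights 1 / (k + 1) lie in (0, 1] and let the strictly feasible part fade
    out.\<close>
  have "(\<lambda>k. (1 - inverse (real (Suc k))) * cost X K + inverse (real (Suc k)) * cost Z K0)
    \<longlonglongrightarrow> (1 - 0) * cost X K + 0 * cost Z K0"
    by (intro tendsto_intros LIMSEQ_inverse_real_of_nat)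
  then have "?J \<le> (1 - 0) * cost X K + 0 * cost Z K0"
    by (rule LIMSEQ_le_const) (use le in \<open>auto intro!: exI[of _ 0] simp: inverse_le_1_iff\<close>)
  then show ?thesis by simp
qed

end

theorem theorem7:
  fixes A :: "real^'n^'n" and B :: "real^'m^'n" and Bw :: "real^'n^'n"
    and Q2 :: "real^'n^'n" and R2 :: "real^'m^'m"
    and Qi :: "real^'n^'n" and Ri :: "real^'m^'m" and beta :: real
  assumes weights: "psd Q2" "pd R2" "pd Qi" "pd Ri" and beta_pos: "beta > 0"
    and stabilizable: "\<exists>K. hurwitz (A + B ** K)"
    and detectable: "\<exists>L::real^'n^'n. hurwitz (A + L ** msqrt Q2)"
    and beta_gt: "beta > (INF K\<in>stabilizing_set A B. hinf_norm A B Bw Qi Ri K)"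
    and W_pd: "pd (Bw ** transpose Bw)"
  shows "\<exists>p\<in>Fcvx_set A B Bw Q2 R2 Qi Ri beta.
           (\<forall>q\<in>Fcvx_set A B Bw Q2 R2 Qi Ri beta. fst p \<le> fst q) \<and>
           (INF K\<in>Kbeta A B Bw Qi Ri beta. Jmix A B Bw Q2 R2 Qi Ri beta K) = fst p"
proof -
  interpret mixed_design A B Bw Q2 Qi R2 Ri beta
    using assms by unfold_locales auto
  let ?F = "Fcvx_set A B Bw Q2 R2 Qi Ri beta" and ?K = "Kbeta A B Bw Qi Ri beta"
  let ?J = "Jmix A B Bw Q2 R2 Qi Ri beta"
  have "stabilizing_set A B \<noteq> {}"
    using stabilizable by (auto simp: stabilizing_set_def closed_loop_def)
  \<comment> \<open>The strict bound on the infimum over this nonempty set yields a gain with norm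
    below beta.\<close>
  then obtain K0 where K0: "K0 \<in> ?K"
    using cInf_lessD[of "hinf_norm A B Bw Qi Ri ` stabilizing_set A B" beta] beta_gt
    by (auto simp: Kbeta_def)
  have "psd (- lmi (XK A B Bw Qi Ri beta K) K)" if "K \<in> ?K" for K
    by (simp add: XK_feasible(2)[OF that] psd_zero)
  note XK = XK_feasible(1) this XK_feasible(3)
  obtain X K where X: "pd X" "psd (- lmi X K)"
    and min: "\<And>Z L. pd Z \<Longrightarrow> psd (- lmi Z L) \<Longrightarrow> cost X K \<le> cost Z L"
    by (rule cost_attains_min[OF XK(1,2)[OF K0]], blast)
  have J: "cost X K \<le> ?J L" if "L \<in> ?K" for L
    using min[OF XK(1,2)[OF that]] XK(3)[OF that] by simp
  show ?thesis
  proof (intro bexI conjI ballI)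
    show p: "(cost X K, X, K ** X) \<in> ?F" unfolding Fcvx_set_iff using X by blast
    show "fst (cost X K, X, K ** X) \<le> fst q" if "q \<in> ?F" for q
    proof -
      obtain g Z Y where q: "q = (g, Z, Y)" by (cases q)
      with that obtain L where "pd Z" "psd (- lmi Z L)" "cost Z L \<le> g" by (auto simp: Fcvx_set_iff)
      with min[of Z L] q show ?thesis by simp
    qed
    have "bdd_below (?J ` ?K)" using J by (intro bdd_belowI[of _ "cost X K"]) auto
    \<comment> \<open>For an infimum of reals a lower bound has to be exhibited; the minimal cost
      itself serves.\<close>
    then have "(INF L\<in>?K. ?J L) \<le> cost X K" by (rule INF_Jmix_le_cost[OF K0 X])
    moreover have "cost X K \<le> (INF L\<in>?K. ?J L)" using K0 J by (intro cINF_greatest) auto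
    ultimately show "(INF L\<in>?K. ?J L) = fst (cost X K, X, K ** X)" by simp
  qed
qed

end
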